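(* Let $q$ be a prime power, let $h\ge 1$ and $n$ be integers, and let $C$ be an $\mathbb F_q$-linear $(n,q^{3h},n-2)_{q^h}$ MDS code over $\mathbb F_{q^h}$. Suppose that one of the following holds: (1) $h=2$ and $n\ge 2q+3$; (2) $h=3$ and $n\ge q^2+3+\delta_{2,q}$, where $\delta_{2,q}=1$ if $q=2$ and $\delta_{2,q}=0$ otherwise. If $C$ has at least three coordinates such that the projection of $C$ from each of them is $\mathbb F_q$-equivalent to a linear code, then $C$ itself is $\mathbb F_q$-equivalent to a linear code.
   Context: A code of length $n$ over $\mathbb F_{q^h}$ is a subset of $\mathbb F_{q^h}^n$; an $(n,M,d)_{q^h}$ code has $M$ codewords and minimum Hamming distance $d$. It is $\mathbb F_q$-linear if it is an $\mathbb F_q$-subspace of $\mathbb F_{q^h}^n$, and linear if it is an $\mathbb F_{q^h}$-subspace. It is MDS if $M=q^{h(n-d+1)}$ (equality in the Singleton bound). Two $\mathbb F_q$-linear codes over $\mathbb F_{q^h}$ are $\mathbb F_q$-equivalent if one is obtained from the other by permuting coordinate positions and applying, in each coordinate position, an $\mathbb F_q$-linear bijection of $\mathbb F_{q^h}$ (possibly different bijections in different positions). The projection of $C$ from position $i$ is the code $\{(x_1,\dots,x_{i-1},x_{i+1},\dots,x_n) : (x_1,\dots,x_{i-1},0,x_{i+1},\dots,x_n)\in C\}$. *)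

theory Defs
  imports Main "HOL-Computational_Algebra.Primes"
begin

definition prime_power :: "nat \<Rightarrow> bool" where
  "prime_power q \<longleftrightarrow> (\<exists>p k. prime p \<and> k \<ge> 1 \<and> q = p ^ k)"

text \<open>A subfield F of the ambient finite field (playing the role of F_q inside F_{q^h}).\<close>
definition is_subfield :: "'a::field set \<Rightarrow> bool" where
  "is_subfield F \<longleftrightarrow> 0 \<in> F \<and> 1 \<in> F \<and>
     (\<forall>x\<in>F. \<forall>y\<in>F. x + y \<in> F \<and> x * y \<in> F) \<and>
     (\<forall>x\<in>F. - x \<in> F) \<and> (\<forall>x\<in>F. x \<noteq> 0 \<longrightarrow> inverse x \<in> F)"

definition code_of_length :: "nat \<Rightarrow> 'a list set \<Rightarrow> bool" where
  "code_of_length n C \<longleftrightarrow> (\<forall>x\<in>C. length x = n)"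

definition hamming :: "'a list \<Rightarrow> 'a list \<Rightarrow> nat" where
  "hamming x y = card {i. i < length x \<and> x ! i \<noteq> y ! i}"

definition min_dist :: "'a list set \<Rightarrow> nat" where
  "min_dist C = Min {hamming x y | x y. x \<in> C \<and> y \<in> C \<and> x \<noteq> y}"

definition is_nMd_code :: "nat \<Rightarrow> nat \<Rightarrow> nat \<Rightarrow> 'a list set \<Rightarrow> bool" where
  "is_nMd_code n M d C \<longleftrightarrow> code_of_length n C \<and> card C = M \<and> min_dist C = d"

definition is_MDS :: "nat \<Rightarrow> ('a::finite) list set \<Rightarrow> bool" where
  "is_MDS n C \<longleftrightarrow> card C = card (UNIV :: 'a set) ^ (n - min_dist C + 1)"

definition F_linear_code :: "'a::field set \<Rightarrow> nat \<Rightarrow> 'a list set \<Rightarrow> bool" where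
  "F_linear_code F n C \<longleftrightarrow> code_of_length n C \<and> replicate n 0 \<in> C \<and>
     (\<forall>x\<in>C. \<forall>y\<in>C. map2 (+) x y \<in> C) \<and>
     (\<forall>c\<in>F. \<forall>x\<in>C. map ((*) c) x \<in> C)"

definition linear_code :: "nat \<Rightarrow> 'a::field list set \<Rightarrow> bool" where
  "linear_code n C \<longleftrightarrow> F_linear_code UNIV n C"

definition F_linear_map :: "'a::field set \<Rightarrow> ('a \<Rightarrow> 'a) \<Rightarrow> bool" where
  "F_linear_map F f \<longleftrightarrow> (\<forall>x y. f (x + y) = f x + f y) \<and> (\<forall>c\<in>F. \<forall>x. f (c * x) = c * f x)"

definition F_equiv :: "'a::field set \<Rightarrow> nat \<Rightarrow> 'a list set \<Rightarrow> 'a list set \<Rightarrow> bool" where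
  "F_equiv F n C D \<longleftrightarrow> (\<exists>\<sigma> \<phi>. bij_betw \<sigma> {..<n} {..<n} \<and>
      (\<forall>j<n. bij (\<phi> j) \<and> F_linear_map F (\<phi> j)) \<and>
      D = (\<lambda>x. map (\<lambda>j. \<phi> j (x ! \<sigma> j)) [0..<n]) ` C)"

definition proj :: "nat \<Rightarrow> 'a::zero list set \<Rightarrow> 'a list set" where
  "proj i C = {take i x @ drop (Suc i) x | x. x \<in> C \<and> x ! i = 0}"

end

theory Submission
  imports Defs "HOL-Computational_Algebra.Polynomial" "HOL-Library.FuncSet"
begin

text \<open>
  Let \<open>i\<close>, \<open>k\<close>, \<open>l\<close> be the three special coordinates. For every other coordinate \<open>j\<close>, consider the
  codewords vanishing at \<open>j\<close>. Linearity of the projections from \<open>i\<close>, \<open>k\<close> and \<open>l\<close> means that, after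
  \<open>F\<close>-linear changes of variable that do not depend on \<open>j\<close>, these codewords relate any two of
  the special entries, when the third one is zero, by a scalar \<open>b j\<close>, \<open>a j\<close> or \<open>c j\<close>.
  Compatibility of the three relations reads \<open>b j * t (c j * x) = u (a j * v x)\<close> with
  \<open>F\<close>-linear bijections \<open>t\<close>, \<open>u\<close>, \<open>v\<close> that do not depend on \<open>j\<close>.

  Write \<open>F\<close>-linear maps as \<open>q\<close>-polynomials. If one of \<open>t\<close>, \<open>u\<close>, \<open>v\<close> is a monomial
  \<open>p * x ^ (q ^ m)\<close>, then twisting by the Frobenius map exhibits the code as equivalent to a linear
  one. If none of them is, then the number \<open>n - 3\<close> of triples \<open>(a j, b j, c j)\<close> is at most the
  maximum of \<open>q ^ (h - 1) - 1\<close> and \<open>h * (q - 1)\<close>, contradicting the assumed length.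
\<close>

subsection \<open>Linearized polynomials over a finite field\<close>

text \<open>Multiplication by a nonzero \<open>x\<close> permutes the nonzero elements of
  \<open>F\<close>; comparing the products over all of them gives
  \<open>x ^ (card F - 1) = 1\<close>.\<close>

lemma subfield_power_card:
  fixes F :: "'a::{finite,field} set"
  assumes "is_subfield F" "x \<in> F"
  shows "x ^ card F = x"
proof (cases "x = 0")
  case True
  have "card F > 0" using assms by (auto simp: card_gt_0_iff)
  with True show ?thesis by simp
next
  case False
  have inv: "inverse y \<in> F" if "y \<in> F" for y
    using assms that by (cases "y = 0") (auto simp: is_subfield_def)
  have mult: "y * z \<in> F" if "y \<in> F" "z \<in> F" for y z
    using assms that by (auto simp: is_subfield_def)
  have "(\<Prod>y\<in>F-{0}. x * y) = (\<Prod>y\<in>F-{0}. y)"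
    by (rule prod.reindex_bij_witness[of _ "\<lambda>y. y * inverse x" "\<lambda>y. x * y"])
       (use False assms(2) mult inv[OF assms(2)] in \<open>auto simp: mult.assoc mult.left_commute\<close>)
  moreover have "(\<Prod>y\<in>F-{0}. x * y) = x ^ card (F - {0}) * (\<Prod>y\<in>F-{0}. y)"
    by (simp add: prod.distrib)
  moreover have "(\<Prod>y\<in>F-{0}. y) \<noteq> 0" by simp
  ultimately have "x ^ card (F - {0}) = 1" by simp
  moreover have "card F = Suc (card (F - {0}))"
    using assms by (intro card.remove) (auto simp: is_subfield_def)
  ultimately show ?thesis by simp
qed

text \<open>Translation by 1 permutes the field, so it leaves the sum of all elements
  unchanged.\<close>

lemma of_nat_card_UNIV_eq_0: "of_nat (card (UNIV :: 'a::{finite,field} set)) = (0 :: 'a)"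
proof -
  have "(\<Sum>y\<in>(UNIV :: 'a set). y + 1) = (\<Sum>y\<in>(UNIV :: 'a set). y)"
    by (rule sum.reindex_bij_witness[of _ "\<lambda>y. y - 1" "\<lambda>y. y + 1"]) auto
  thus ?thesis by (simp add: sum.distrib)
qed

locale subfield_extension =
  fixes F :: "'a::{finite,field} set" and q h :: nat
  assumes prime_power_q: "prime_power q"
    and h_pos: "h \<ge> 1"
    and card_UNIV_eq: "card (UNIV :: 'a set) = q ^ h"
    and subfield_F: "is_subfield F"
    and card_F: "card F = q"
begin

section \<open>Arithmetic of the subfield and powers of the Frobenius map\<close>

lemma F_zero [simp]: "0 \<in> F" and F_one [simp]: "1 \<in> F"
  and F_add: "x \<in> F \<Longrightarrow> y \<in> F \<Longrightarrow> x + y \<in> F"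
  and F_mult: "x \<in> F \<Longrightarrow> y \<in> F \<Longrightarrow> x * y \<in> F"
  and F_uminus: "x \<in> F \<Longrightarrow> - x \<in> F"
  using subfield_F by (auto simp: is_subfield_def)

lemma F_inverse: "x \<in> F \<Longrightarrow> inverse x \<in> F"
  using subfield_F by (cases "x = 0") (auto simp: is_subfield_def)

lemma F_divide: "x \<in> F \<Longrightarrow> y \<in> F \<Longrightarrow> x / y \<in> F"
  by (simp add: divide_inverse F_inverse F_mult)

lemma F_diff: "x \<in> F \<Longrightarrow> y \<in> F \<Longrightarrow> x - y \<in> F"
  using F_add[of x "- y"] by (simp add: F_uminus)

lemma q_gt_1: "q > 1"
proof -
  from prime_power_q obtain p k where "prime p" "k \<ge> 1" "q = p ^ k"
    by (auto simp: prime_power_def)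
  thus ?thesis using one_less_power[OF prime_gt_1_nat, of p k] by simp
qed

text \<open>The characteristic divides the field size \<open>q ^ h\<close>, so it is the prime
  underlying \<open>q\<close>. This is what makes \<open>q\<close>-th powers additive.\<close>

lemma CHAR_power: "prime CHAR('a) \<and> (\<exists>k. q = CHAR('a) ^ k)"
proof -
  from prime_power_q obtain p k where p: "prime p" "q = p ^ k"
    by (auto simp: prime_power_def)
  have "CHAR('a) > 0"
    by (rule finite_imp_CHAR_pos) simp
  hence "prime CHAR('a)" by (rule prime_CHAR_semidom)
  moreover have "CHAR('a) dvd p ^ (k * h)"
    using of_nat_card_UNIV_eq_0[where 'a='a] unfolding of_nat_eq_0_iff_char_dvd card_UNIV_eq
    by (simp add: p power_mult)
  ultimately have "CHAR('a) = p"
    using p(1) prime_dvd_power primes_dvd_imp_eq by blast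
  thus ?thesis using p by auto
qed

lemma frob_add: "(x + y) ^ (q ^ k) = x ^ (q ^ k) + (y :: 'a) ^ (q ^ k)"
proof -
  from CHAR_power obtain l where "q = CHAR('a) ^ l" by auto
  thus ?thesis using CHAR_power by (intro freshmans_dream'[of _ "l * k"]) (auto simp: power_mult)
qed

lemma frob_sum: "(\<Sum>i\<in>I. f i) ^ (q ^ k) = (\<Sum>i\<in>I. f i ^ (q ^ k) :: 'a)"
proof -
  from CHAR_power obtain l where "q = CHAR('a) ^ l" by auto
  thus ?thesis using CHAR_power by (intro freshmans_dream_sum'[of _ "l * k"]) (auto simp: power_mult)
qed

lemma frob_h [simp]: "(x :: 'a) ^ (q ^ h) = x"
  using subfield_power_card[of UNIV x] card_UNIV_eq by (simp add: is_subfield_def)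

lemma F_frob: "x \<in> F \<Longrightarrow> x ^ (q ^ k) = x"
proof (induction k)
  case (Suc k)
  have "x ^ (q ^ Suc k) = (x ^ (q ^ k)) ^ q" by (simp add: mult.commute flip: power_mult)
  thus ?case using Suc subfield_power_card[OF subfield_F] card_F by simp
qed auto

text \<open>The \<open>q\<close> elements of \<open>F\<close> are roots of \<open>x ^ q - x\<close>,
  whose degree leaves room for no others.\<close>

lemma frob_fixed: "(x :: 'a) ^ q = x \<longleftrightarrow> x \<in> F"
proof -
  define P where "P = monom (1 :: 'a) q - monom 1 1"
  have "coeff P q = 1" using q_gt_1 by (simp add: P_def)
  hence "P \<noteq> 0" by auto
  have deg: "degree P \<le> q" using q_gt_1 unfolding P_def
    by (intro degree_diff_le) (auto simp: degree_monom_eq)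
  have poly: "poly P x = 0 \<longleftrightarrow> x ^ q = x" for x by (simp add: P_def poly_monom)
  have "F \<subseteq> {x. poly P x = 0}" using F_frob[of _ 1] poly by auto
  moreover have "card {x. poly P x = 0} \<le> card F"
    using card_poly_roots_bound[OF \<open>P \<noteq> 0\<close>] deg card_F by simp
  ultimately have "F = {x. poly P x = 0}" by (intro card_seteq) auto
  thus ?thesis using poly by auto
qed

lemma frob_power: "(x ^ (q ^ k)) ^ (q ^ l) = (x :: 'a) ^ (q ^ (k + l))"
  by (simp add: power_add power_mult)

text \<open>Exponents with \<open>k < h\<close> suffice because \<open>x ^ (q ^ h) = x\<close>; they
  keep the degree below the field size, so the map determines the coefficients.\<close>

definition qpoly :: "(nat \<Rightarrow> 'a) \<Rightarrow> 'a \<Rightarrow> 'a" where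
  "qpoly p x = (\<Sum>k<h. p k * x ^ (q ^ k))"

text \<open>A nonzero polynomial of degree at most \<open>q ^ (h - 1)\<close> cannot vanish at all
  \<open>q ^ h\<close> points.\<close>

lemma qpoly_eq_0_imp:
  assumes "\<And>x. qpoly p x = 0" "k < h"
  shows "p k = 0"
proof -
  define P where "P = (\<Sum>k<h. monom (p k) (q ^ k))"
  have coeff: "coeff P (q ^ k) = p k" if "k < h" for k
  proof -
    have "coeff P (q ^ k) = (\<Sum>l<h. if l = k then p l else 0)"
      unfolding P_def coeff_sum using q_gt_1
      by (intro sum.cong refl) (simp add: power_inject_exp)
    thus ?thesis using that by simp
  qed
  have poly: "poly P x = qpoly p x" for x
    by (simp add: P_def qpoly_def poly_sum poly_monom)
  have "degree P \<le> q ^ (h - 1)" unfolding P_def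
  proof (rule degree_sum_le, simp)
    fix k assume "k \<in> {..<h}"
    hence "q ^ k \<le> q ^ (h - 1)" using q_gt_1 by (intro power_increasing) auto
    thus "degree (monom (p k) (q ^ k)) \<le> q ^ (h - 1)"
      using degree_monom_le order.trans by blast
  qed
  moreover have "q ^ (h - 1) < q ^ h" using q_gt_1 h_pos by (intro power_strict_increasing) auto
  moreover have "card {x. poly P x = 0} = q ^ h" using assms(1) poly card_UNIV_eq by simp
  ultimately have "P = 0" using card_poly_roots_bound[of P] by fastforce
  thus ?thesis using coeff[OF assms(2)] by simp
qed

lemma qpoly_eqD:
  assumes "\<And>x. qpoly p x = qpoly r x" "k < h"
  shows "p k = r k"
proof -
  have "qpoly (\<lambda>k. p k - r k) x = 0" for x
    using assms(1)[of x] by (simp add: qpoly_def algebra_simps sum_subtractf)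
  from qpoly_eq_0_imp[OF this assms(2)] show ?thesis by simp
qed

section \<open>Linear independence over \<open>F\<close> and bases, by counting\<close>

definition indep :: "(nat \<Rightarrow> 'a) \<Rightarrow> nat \<Rightarrow> bool" where
  "indep e m \<longleftrightarrow> (\<forall>f. (\<forall>i<m. f i \<in> F) \<longrightarrow> (\<Sum>i<m. f i * e i) = 0 \<longrightarrow> (\<forall>i<m. f i = 0))"

text \<open>Extensional coefficient functions form a finite set of exactly \<open>q ^ m\<close>
  elements, on which the counting arguments rest.\<close>

definition combs :: "(nat \<Rightarrow> 'a) \<Rightarrow> nat \<Rightarrow> 'a set" where
  "combs e m = (\<lambda>f. \<Sum>i<m. f i * e i) ` ({..<m} \<rightarrow>\<^sub>E F)"

lemma card_combs_le: "card (combs e m) \<le> q ^ m"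
proof -
  have "card (combs e m) \<le> card ({..<m} \<rightarrow>\<^sub>E F)"
    unfolding combs_def by (intro card_image_le finite_PiE) auto
  thus ?thesis by (simp add: card_PiE card_F)
qed

lemma combsI:
  assumes "\<And>i. i < m \<Longrightarrow> f i \<in> F"
  shows "(\<Sum>i<m. f i * e i) \<in> combs e m"
  unfolding combs_def
  by (rule image_eqI[of _ _ "restrict f {..<m}"]) (use assms in auto)

lemma combsE:
  assumes "x \<in> combs e m"
  obtains f where "\<And>i. i < m \<Longrightarrow> f i \<in> F" "x = (\<Sum>i<m. f i * e i)"
  using assms unfolding combs_def by (auto simp: PiE_iff)

text \<open>By independence the \<open>q ^ h\<close> coefficient tuples give distinct sums, which
  exhaust the field.\<close>

lemma combs_indep_UNIV:
  assumes "indep e h"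
  shows "combs e h = UNIV"
proof -
  have "inj_on (\<lambda>f. \<Sum>i<h. f i * e i) ({..<h} \<rightarrow>\<^sub>E F)"
  proof (rule inj_onI)
    fix f g assume f: "f \<in> {..<h} \<rightarrow>\<^sub>E F" and g: "g \<in> {..<h} \<rightarrow>\<^sub>E F"
      and eq: "(\<Sum>i<h. f i * e i) = (\<Sum>i<h. g i * e i)"
    have "(\<Sum>i<h. (f i - g i) * e i) = 0"
      unfolding left_diff_distrib sum_subtractf eq by simp
    moreover have "f i - g i \<in> F" if "i < h" for i
      using that PiE_mem[OF f, of i] PiE_mem[OF g, of i] by (intro F_diff) simp_all
    ultimately have "f i - g i = 0" if "i < h" for i
      using assms[unfolded indep_def, rule_format, of "\<lambda>i. f i - g i"] that by blast
    hence "f i = g i" if "i < h" for i using that by simp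
    thus "f = g" by (intro PiE_ext[OF f g]) simp
  qed
  hence "card (combs e h) = card ({..<h} \<rightarrow>\<^sub>E F)"
    unfolding combs_def by (rule card_image)
  also have "\<dots> = card (UNIV :: 'a set)"
    by (simp add: card_PiE card_F card_UNIV_eq)
  finally show ?thesis by (intro card_subset_eq) simp_all
qed

lemma indep_expand:
  assumes "indep e h"
  obtains f where "\<And>i. i < h \<Longrightarrow> f i \<in> F" "x = (\<Sum>i<h. f i * e i)"
proof -
  have "x \<in> combs e h" using combs_indep_UNIV[OF assms] by simp
  thus ?thesis by (rule combsE) (rule that)
qed

lemma indep_extend:
  assumes "indep e m" "x \<notin> combs e m"
  shows "indep (e(m := x)) (Suc m)"
  unfolding indep_def
proof (intro allI impI)
  fix f i assume f: "\<forall>i<Suc m. f i \<in> F" and i: "i < Suc m"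
    and eq: "(\<Sum>i<Suc m. f i * (e(m := x)) i) = 0"
  have "(\<Sum>i<Suc m. f i * (e(m := x)) i) = (\<Sum>i<m. f i * e i) + f m * x" by simp
  hence eq: "(\<Sum>i<m. f i * e i) + f m * x = 0" using eq by simp
  have "f m = 0"
  proof (rule ccontr)
    assume "f m \<noteq> 0"
    hence "x = - (\<Sum>i<m. f i * e i) / f m"
      using eq by (simp add: field_simps add_eq_0_iff)
    also have "\<dots> = (\<Sum>i<m. (- f i / f m) * e i)"
      by (simp add: sum_divide_distrib sum_negf)
    also have "\<dots> \<in> combs e m" by (rule combsI) (use f in \<open>auto intro!: F_divide F_uminus\<close>)
    finally show False using assms by simp
  qed
  moreover from this eq have "(\<Sum>i<m. f i * e i) = 0" by simp
  hence "\<forall>i<m. f i = 0" using assms(1) f unfolding indep_def by (meson less_Suc_eq)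
  ultimately show "f i = 0" using i less_Suc_eq by auto
qed

text \<open>Greedy choice: fewer than \<open>h\<close> vectors span at most
  \<open>q ^ (h - 1)\<close> elements, so some member of \<open>S\<close> lies outside their
  span.\<close>

lemma exists_indep:
  assumes "0 \<notin> S" "card S \<ge> q ^ (h - 1)"
  obtains e where "\<And>i. i < h \<Longrightarrow> e i \<in> S" "indep e h"
proof -
  have "\<exists>e. (\<forall>i<m. e i \<in> S) \<and> indep e m" if "m \<le> h" for m
    using that
  proof (induction m)
    case 0
    show ?case by (simp add: indep_def)
  next
    case (Suc m)
    then obtain e where e: "\<forall>i<m. e i \<in> S" "indep e m" by auto
    have "\<not> S \<subseteq> combs e m"
    proof
      assume "S \<subseteq> combs e m"
      moreover have "0 \<in> combs e m" using combsI[of m "\<lambda>_. 0" e] by simp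
      \<comment> \<open>Since 0 lies in the span but not in \<open>S\<close>, it supplies the one
        element that makes the inequality strict.\<close>
      ultimately have "card (insert 0 S) \<le> card (combs e m)" by (intro card_mono) auto
      also have "\<dots> \<le> q ^ m" by (rule card_combs_le)
      also have "\<dots> \<le> q ^ (h - 1)" using Suc.prems q_gt_1 by (intro power_increasing) auto
      finally show False using assms by simp
    qed
    then obtain x where "x \<in> S" "x \<notin> combs e m" by auto
    hence "(\<forall>i<Suc m. (e(m := x)) i \<in> S) \<and> indep (e(m := x)) (Suc m)"
      using e indep_extend by (auto simp: less_Suc_eq)
    thus ?case by blast
  qed
  from this[of h] show ?thesis using that by auto
qed

section \<open>\<open>F\<close>-linear maps as \<open>q\<close>-polynomials\<close>

lemma F_linear_map_sum:
  assumes "F_linear_map F f" "\<And>i. i \<in> I \<Longrightarrow> c i \<in> F"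
  shows "f (\<Sum>i\<in>I. c i * e i) = (\<Sum>i\<in>I. c i * f (e i))"
proof -
  have "f 0 = 0" using assms(1) unfolding F_linear_map_def by (metis F_zero mult_zero_left)
  with assms show ?thesis
    by (induction I rule: infinite_finite_induct) (auto simp: F_linear_map_def)
qed

lemma qpoly_linear: "F_linear_map F (qpoly p)"
  unfolding F_linear_map_def qpoly_def
  by (simp add: frob_add distrib_left sum.distrib power_mult_distrib F_frob sum_distrib_left
      mult.left_commute)

text \<open>By counting: a linear map is determined by its values on a basis, so there are at most as many
  linear maps as tuples of \<open>h\<close> coefficients, and distinct tuples give distinct maps.\<close>

lemma F_linear_imp_qpoly:
  assumes "F_linear_map F f"
  obtains p where "f = qpoly p"
proof -
  have "q ^ (h - 1) \<le> card (UNIV - {0 :: 'a})"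
  proof -
    have "q ^ (h - 1) < q ^ h" using q_gt_1 h_pos by (intro power_strict_increasing) auto
    thus ?thesis by (simp add: card_Diff_singleton card_UNIV_eq)
  qed
  then obtain e where e: "indep e h"
    using exists_indep[of "UNIV - {0 :: 'a}"] by auto
  define \<Phi> where "\<Phi> = (\<lambda>p. restrict (\<lambda>i. qpoly p (e i)) {..<h})"
  define X where "X = ({..<h} \<rightarrow>\<^sub>E (UNIV :: 'a set))"
  have determined: "f = g" if "F_linear_map F f" "F_linear_map F g" "\<And>i. i < h \<Longrightarrow> f (e i) = g (e i)"
    for f g
  proof
    fix x
    obtain c where c: "\<And>i. i < h \<Longrightarrow> c i \<in> F" "x = (\<Sum>i<h. c i * e i)"
      using indep_expand[OF e] by blast
    thus "f x = g x" using that F_linear_map_sum[of f "{..<h}" c e] F_linear_map_sum[of g "{..<h}" c e]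
      by simp
  qed
  have "inj_on \<Phi> X"
  proof (rule inj_onI)
    fix p r assume p: "p \<in> X" and r: "r \<in> X" and eq: "\<Phi> p = \<Phi> r"
    have "qpoly p (e i) = qpoly r (e i)" if "i < h" for i
      using fun_cong[OF eq, of i] that by (simp add: \<Phi>_def)
    hence "qpoly p = qpoly r" by (intro determined qpoly_linear)
    hence "p k = r k" if "k < h" for k using qpoly_eqD[of p r] that by auto
    thus "p = r" using p r by (auto simp: X_def intro: PiE_ext)
  qed
  moreover have "\<Phi> p \<in> X" for p
    unfolding \<Phi>_def X_def by (rule restrict_PiE_iff[THEN iffD2]) simp
  hence "\<Phi> ` X \<subseteq> X" by blast
  moreover have "finite X" unfolding X_def by (rule finite_PiE) simp_all
  \<comment> \<open>\<open>X\<close> serves both as the set of coefficient tuples and as the set of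
    value tuples, so injectivity yields surjectivity.\<close>
  ultimately have "\<Phi> ` X = X" by (intro endo_inj_surj)
  moreover have "restrict (\<lambda>i. f (e i)) {..<h} \<in> X"
    unfolding X_def by (rule restrict_PiE_iff[THEN iffD2]) simp
  ultimately have "restrict (\<lambda>i. f (e i)) {..<h} \<in> \<Phi> ` X" by simp
  then obtain p where "restrict (\<lambda>i. f (e i)) {..<h} = \<Phi> p" by (rule imageE)
  from fun_cong[OF this] have "f (e i) = qpoly p (e i)" if "i < h" for i
    using that unfolding \<Phi>_def by (metis lessThan_iff restrict_apply')
  hence "f = qpoly p" using assms by (intro determined qpoly_linear)
  thus ?thesis by (rule that)
qed

section \<open>Monomial maps and \<open>q\<close>-polynomials with full support\<close>

definition monomial :: "('a \<Rightarrow> 'a) \<Rightarrow> bool" where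
  "monomial t \<longleftrightarrow> (\<exists>p. \<exists>k<h. t = (\<lambda>x. p * x ^ (q ^ k)))"

text \<open>With at most one nonzero coefficient the map is monomial; this includes the zero map, as
  the factor in \<open>monomial\<close> may be 0.\<close>

lemma not_monomial_support:
  assumes "\<not> monomial (qpoly p)"
  obtains k l where "k < l" "l < h" "p k \<noteq> 0" "p l \<noteq> 0"
proof -
  have "\<exists>k<h. \<exists>l<h. k \<noteq> l \<and> p k \<noteq> 0 \<and> p l \<noteq> 0"
  proof (rule ccontr)
    assume neg: "\<not> ?thesis"
    have "\<exists>k<h. \<forall>l<h. l \<noteq> k \<longrightarrow> p l = 0"
    proof (cases "\<forall>l<h. p l = 0")
      case True
      thus ?thesis using h_pos by (intro exI[of _ 0]) auto
    next
      case False
      thus ?thesis using neg by blast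
    qed
    then obtain k where k: "k < h" "\<And>l. l < h \<Longrightarrow> l \<noteq> k \<Longrightarrow> p l = 0" by blast
    have "qpoly p x = p k * x ^ (q ^ k)" for x
    proof -
      have "qpoly p x = (\<Sum>l\<in>{k}. p l * x ^ (q ^ l))"
        unfolding qpoly_def using k by (intro sum.mono_neutral_right) auto
      thus ?thesis by simp
    qed
    hence "monomial (qpoly p)" using k(1) unfolding monomial_def by blast
    thus False using assms by simp
  qed
  then obtain k l where "k < h" "l < h" "k \<noteq> l" "p k \<noteq> 0" "p l \<noteq> 0" by blast
  thus ?thesis using that[of k l] that[of l k] by (cases "k < l") auto
qed

text \<open>Raising to the power \<open>q ^ (h - k)\<close> shows that \<open>e\<close> is fixed by
  the power \<open>q ^ (l - k)\<close>. If \<open>l - k = 2\<close>, then \<open>h = 3\<close>, and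
  one more \<open>q\<close>-th power reaches \<open>e ^ (q ^ 3) = e\<close>, so
  \<open>e ^ q = e\<close>.\<close>

lemma frob_eq_imp_F:
  assumes "h = 2 \<or> h = 3" "k < l" "l < h" "(e :: 'a) ^ (q ^ k) = e ^ (q ^ l)"
  shows "e \<in> F"
proof -
  have "e = e ^ (q ^ (l - k))"
  proof -
    have "(e ^ (q ^ k)) ^ (q ^ (h - k)) = (e ^ (q ^ l)) ^ (q ^ (h - k))" using assms by simp
    also have "\<dots> = e ^ (q ^ (h + (l - k)))"
    proof -
      have "l + (h - k) = h + (l - k)" using assms by simp
      thus ?thesis unfolding frob_power by simp
    qed
    also have "\<dots> = (e ^ (q ^ h)) ^ (q ^ (l - k))" by (simp only: frob_power)
    also have "(e ^ (q ^ k)) ^ (q ^ (h - k)) = e ^ (q ^ h)" unfolding frob_power using assms by simp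
    finally show ?thesis by simp
  qed
  moreover have "l - k = 1 \<or> (l - k = 2 \<and> h = 3)" using assms by linarith
  moreover have "e = e ^ q" if "e = e ^ (q ^ 2)" "h = 3"
  proof -
    have "(e ^ (q ^ 2)) ^ (q ^ 1) = e ^ (q ^ h)" unfolding frob_power using that(2) by simp
    thus ?thesis using that(1) by simp
  qed
  ultimately show ?thesis unfolding frob_fixed[symmetric] by fastforce
qed

text \<open>Comparing two nonzero coefficients shows that the scalar is fixed by a nontrivial power of the
  Frobenius map, hence lies in \<^term>\<open>F\<close> because \<open>h\<close> is prime.\<close>

lemma not_monomial_scalar:
  assumes "h = 2 \<or> h = 3" "F_linear_map F t" "\<not> monomial t" "\<And>z. t (e * z) = d * t z"
  shows "e \<in> F" "d = e"
proof -
  obtain p where p: "t = qpoly p" using F_linear_imp_qpoly assms(2) by blast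
  obtain k l where kl: "k < l" "l < h" "p k \<noteq> 0" "p l \<noteq> 0"
    using not_monomial_support assms(3) p by blast
  have "qpoly (\<lambda>k. p k * e ^ (q ^ k)) z = qpoly (\<lambda>k. d * p k) z" for z
    using assms(4)[of z] by (simp add: p qpoly_def power_mult_distrib sum_distrib_left mult.assoc)
  from qpoly_eqD[OF this] have eq: "p m * e ^ (q ^ m) = d * p m" if "m < h" for m using that by blast
  from eq[of k] eq[of l] have d: "e ^ (q ^ k) = d" "e ^ (q ^ l) = d" using kl by auto
  thus "e \<in> F" using frob_eq_imp_F[OF assms(1) kl(1,2), of e] by simp
  thus "d = e" using d F_frob by simp
qed

definition full :: "(nat \<Rightarrow> 'a) \<Rightarrow> bool" where
  "full p \<longleftrightarrow> (\<forall>k<h. p k \<noteq> 0)"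

lemma qpoly_3: "h = 3 \<Longrightarrow> qpoly p x = p 0 * x + p 1 * x ^ q + p 2 * x ^ (q ^ 2)"
  unfolding qpoly_def by (simp add: eval_nat_numeral add_ac)

text \<open>For \<open>h = 2\<close>, two nonzero coefficients are all of them. For
  \<open>h = 3\<close>, if just one coefficient of \<open>p\<close> vanishes, then coefficients 1
  and 2 of the composite are two-term sums equal to 0, which forces the coefficients of
  \<open>r\<close> to vanish all together or not at all.\<close>

lemma full_or_full_inverse:
  assumes "h = 2 \<or> h = 3" "\<not> monomial (qpoly p)" "\<not> monomial (qpoly r)"
    and inv: "\<And>x. qpoly p (qpoly r x) = x"
  shows "full p \<or> full r"
  using assms(1)
proof
  assume h: "h = 2"
  obtain k l where "k < l" "l < h" "p k \<noteq> 0" "p l \<noteq> 0" using not_monomial_support[OF assms(2)] .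
  hence "full p" unfolding full_def using h by (auto simp: less_2_cases_iff)
  thus ?thesis ..
next
  assume h: "h = 3"
  \<comment> \<open>The coefficients of the composite: indices add modulo 3, and a coefficient of
    \<open>r\<close> is raised to the power of \<open>q\<close> belonging to its partner in
    \<open>p\<close>.\<close>
  define w where "w k =
    (if k = 0 then p 0 * r 0 + p 1 * r 2 ^ q + p 2 * r 1 ^ (q ^ 2)
     else if k = 1 then p 0 * r 1 + p 1 * r 0 ^ q + p 2 * r 2 ^ (q ^ 2)
     else p 0 * r 2 + p 1 * r 1 ^ q + p 2 * r 0 ^ (q ^ 2))" for k :: nat
  have "qpoly w x = qpoly (\<lambda>k. if k = 0 then 1 else 0) x" for x
  proof -
    have 1: "(x ^ q) ^ q = x ^ (q ^ 2)" "(x ^ (q ^ 2)) ^ q = x"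
      "(x ^ q) ^ (q ^ 2) = x" "(x ^ (q ^ 2)) ^ (q ^ 2) = x ^ q"
      using frob_power[of x 1 1] frob_power[of x 2 1] frob_power[of x 1 2] frob_power[of x 2 2]
        frob_power[of x 3 1] frob_h[of x] h by (simp_all add: numeral_2_eq_2 numeral_3_eq_3)
    have "(y + z) ^ q = y ^ q + z ^ q" for y z :: 'a using frob_add[of y z 1] by simp
    hence "(qpoly r x) ^ q = r 0 ^ q * x ^ q + r 1 ^ q * x ^ (q ^ 2) + r 2 ^ q * x"
      unfolding qpoly_3[OF h] by (simp only: power_mult_distrib 1)
    moreover have "(qpoly r x) ^ (q ^ 2) = r 0 ^ (q ^ 2) * x ^ (q ^ 2) + r 1 ^ (q ^ 2) * x + r 2 ^ (q ^ 2) * x ^ q"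
      unfolding qpoly_3[OF h] by (simp only: power_mult_distrib frob_add 1)
    ultimately have "qpoly p (qpoly r x) = qpoly w x"
      unfolding qpoly_3[OF h, of p "qpoly r x"] by (simp add: qpoly_3[OF h] w_def algebra_simps)
    moreover have "qpoly (\<lambda>k. if k = 0 then 1 else 0) x = x" by (simp add: qpoly_3[OF h])
    ultimately show ?thesis by (simp only: inv)
  qed
  from qpoly_eqD[OF this, of 1] qpoly_eqD[OF this, of 2]
  have eq: "p 0 * r 1 + p 1 * r 0 ^ q + p 2 * r 2 ^ (q ^ 2) = 0"
    "p 0 * r 2 + p 1 * r 1 ^ q + p 2 * r 0 ^ (q ^ 2) = 0"
    using h by (simp_all add: w_def)
  have pow_0: "(y :: 'a) ^ q = 0 \<longleftrightarrow> y = 0" "y ^ (q ^ 2) = 0 \<longleftrightarrow> y = 0" for y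
    using q_gt_1 by simp_all
  have both: "a = 0 \<longleftrightarrow> b = 0" if "x * a + y * b = 0" "x \<noteq> 0" "y \<noteq> 0" for a b x y :: 'a
    using that by auto
  have lt3: "k < 3 \<longleftrightarrow> k = 0 \<or> k = 1 \<or> k = 2" for k :: nat by auto
  have r: "\<not> (r 0 = 0 \<and> r 1 = 0 \<and> r 2 = 0)"
  proof -
    obtain k l where "l < h" "r l \<noteq> 0" using not_monomial_support[OF assms(3)] .
    thus ?thesis unfolding h lt3 by auto
  qed
  obtain k l where kl: "k < l" "l < h" "p k \<noteq> 0" "p l \<noteq> 0" using not_monomial_support[OF assms(2)] .
  hence "(k = 0 \<and> l = 1) \<or> (k = 0 \<and> l = 2) \<or> (k = 1 \<and> l = 2)" using h by auto
  hence "(p 0 \<noteq> 0 \<and> p 1 \<noteq> 0) \<or> (p 0 \<noteq> 0 \<and> p 2 \<noteq> 0) \<or> (p 1 \<noteq> 0 \<and> p 2 \<noteq> 0)" using kl by blast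
  then consider "p 0 \<noteq> 0" "p 1 \<noteq> 0" "p 2 \<noteq> 0" | "p 0 = 0" "p 1 \<noteq> 0" "p 2 \<noteq> 0"
    | "p 0 \<noteq> 0" "p 1 = 0" "p 2 \<noteq> 0" | "p 0 \<noteq> 0" "p 1 \<noteq> 0" "p 2 = 0" by blast
  hence "(p 0 \<noteq> 0 \<and> p 1 \<noteq> 0 \<and> p 2 \<noteq> 0) \<or> (r 0 \<noteq> 0 \<and> r 1 \<noteq> 0 \<and> r 2 \<noteq> 0)"
  proof cases
    case 2
    have "r 0 ^ q = 0 \<longleftrightarrow> r 2 ^ (q ^ 2) = 0" "r 1 ^ q = 0 \<longleftrightarrow> r 0 ^ (q ^ 2) = 0"
      using 2 eq by (intro both[of "p 1" _ "p 2"]; simp)+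
    thus ?thesis using r unfolding pow_0 by blast
  next
    case 3
    have "r 1 = 0 \<longleftrightarrow> r 2 ^ (q ^ 2) = 0" "r 2 = 0 \<longleftrightarrow> r 0 ^ (q ^ 2) = 0"
      using 3 eq by (intro both[of "p 0" _ "p 2"]; simp)+
    thus ?thesis using r unfolding pow_0 by blast
  next
    case 4
    have "r 1 = 0 \<longleftrightarrow> r 0 ^ q = 0" "r 2 = 0 \<longleftrightarrow> r 1 ^ q = 0"
      using 4 eq by (intro both[of "p 0" _ "p 1"]; simp)+
    thus ?thesis using r unfolding pow_0 by blast
  qed blast
  thus ?thesis unfolding full_def using h by (auto simp: lt3)
qed

section \<open>The trace to \<open>F\<close> and the bound on the number of triples\<close>

definition tr :: "'a \<Rightarrow> 'a" where "tr x = (\<Sum>k<h. x ^ (q ^ k))"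

text \<open>The \<open>q\<close>-th power permutes the summands cyclically, so it fixes the
  trace.\<close>

lemma tr_in_F: "tr x \<in> F"
proof -
  have "(tr x) ^ (q ^ 1) = (\<Sum>k<h. x ^ (q ^ Suc k))"
    unfolding tr_def frob_sum frob_power by simp
  also have "\<dots> = tr x"
  proof -
    have "x ^ (q ^ 0) + (\<Sum>k<h. x ^ (q ^ Suc k)) = (\<Sum>k<h. x ^ (q ^ k)) + x ^ (q ^ h)"
      by (rule trans[OF sum.lessThan_Suc_shift[symmetric] sum.lessThan_Suc])
    thus ?thesis by (simp add: tr_def)
  qed
  finally show ?thesis using frob_fixed by simp
qed

lemma tr_diff: "tr (x - y) = tr x - tr y"
proof -
  have "tr ((x - y) + y) = tr (x - y) + tr y"
    unfolding tr_def frob_add sum.distrib ..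
  thus ?thesis by simp
qed

lemma tr_scale: "c \<in> F \<Longrightarrow> tr (c * x) = c * tr x"
  by (simp add: tr_def power_mult_distrib F_frob sum_distrib_left)

text \<open>As a function of \<open>y\<close>, \<open>tr (c * y)\<close> is a
  \<open>q\<close>-polynomial whose coefficient at index 0 is \<open>c\<close>.\<close>

lemma tr_nondegenerate:
  assumes "\<And>y. tr (c * y) = 0"
  shows "c = 0"
proof -
  have "qpoly (\<lambda>k. c ^ (q ^ k)) y = 0" for y
    using assms[of y] by (simp add: qpoly_def tr_def power_mult_distrib)
  from qpoly_eq_0_imp[OF this, of 0] show ?thesis using h_pos by simp
qed

text \<open>Both sides depend only on the tensors \<open>\<Sum>w i \<otimes> c i\<close> and \<open>\<Sum>w' i \<otimes> c' i\<close> over \<^term>\<open>F\<close>. A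
  \<open>q\<close>-polynomial without vanishing coefficients separates tensors, exactly as the trace does; the
  advantage of the trace is that its values lie in \<^term>\<open>F\<close>.\<close>

lemma full_qpoly_to_tr:
  assumes "full p"
    and "\<And>z. (\<Sum>i\<in>I. w i * qpoly p (c i * z)) = (\<Sum>i\<in>I. w' i * qpoly p (c' i * z))"
  shows "(\<Sum>i\<in>I. w i * tr (c i * y)) = (\<Sum>i\<in>I. w' i * tr (c' i * y))"
proof -
  have expand: "(\<Sum>i\<in>I. w i * qpoly p (c i * z)) = qpoly (\<lambda>k. p k * (\<Sum>i\<in>I. w i * c i ^ (q ^ k))) z"
    for w c z
  proof -
    have "(\<Sum>i\<in>I. w i * qpoly p (c i * z)) = (\<Sum>i\<in>I. \<Sum>k<h. p k * (w i * c i ^ (q ^ k)) * z ^ (q ^ k))"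
      by (simp add: qpoly_def sum_distrib_left power_mult_distrib mult_ac)
    also have "\<dots> = (\<Sum>k<h. \<Sum>i\<in>I. p k * (w i * c i ^ (q ^ k)) * z ^ (q ^ k))"
      by (rule sum.swap)
    finally show ?thesis by (simp add: qpoly_def sum_distrib_left sum_distrib_right)
  qed
  \<comment> \<open>Fullness allows \<open>p k\<close> to be cancelled from every
    coefficient.\<close>
  have coeffs: "(\<Sum>i\<in>I. w i * c i ^ (q ^ k)) = (\<Sum>i\<in>I. w' i * c' i ^ (q ^ k))" if "k < h" for k
    using qpoly_eqD[OF assms(2)[unfolded expand] that] that assms(1) by (simp add: full_def)
  have tr: "(\<Sum>i\<in>I. w i * tr (c i * y)) = (\<Sum>k<h. (\<Sum>i\<in>I. w i * c i ^ (q ^ k)) * y ^ (q ^ k))" for w c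
  proof -
    have "(\<Sum>i\<in>I. w i * tr (c i * y)) = (\<Sum>i\<in>I. \<Sum>k<h. w i * c i ^ (q ^ k) * y ^ (q ^ k))"
      by (simp add: tr_def sum_distrib_left power_mult_distrib mult_ac)
    also have "\<dots> = (\<Sum>k<h. \<Sum>i\<in>I. w i * c i ^ (q ^ k) * y ^ (q ^ k))"
      by (rule sum.swap)
    finally show ?thesis by (simp add: sum_distrib_right)
  qed
  show ?thesis unfolding tr using coeffs by simp
qed

text \<open>If the \<open>b j\<close> span the field, take a basis among them. The corresponding \<open>a j\<close> form a basis
  too, and expanding any further \<open>a j\<close> and \<open>b j\<close> in these bases and comparing traces forces
  \<open>c j\<close>, and then \<open>b j\<close>, to be proportional over \<^term>\<open>F\<close> to a basis member. Otherwise the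
  \<open>b j\<close> are nonzero vectors of a hyperplane.\<close>

lemma full_bound:
  assumes h: "h = 2 \<or> h = 3" and "full p"
    and u: "F_linear_map F u" "\<not> monomial u" and v: "surj v"
    and J: "finite J" and nz: "\<And>j. j \<in> J \<Longrightarrow> a j \<noteq> 0 \<and> b j \<noteq> 0 \<and> c j \<noteq> 0"
    and inj: "inj_on b J"
    and rel: "\<And>j x. j \<in> J \<Longrightarrow> b j * qpoly p (c j * x) = u (a j * v x)"
  shows "card J \<le> max (q ^ (h - 1) - 1) (h * (q - 1))"
proof (cases "card J < q ^ (h - 1)")
  case True
  thus ?thesis by simp
next
  case False
  have "0 \<notin> b ` J" using nz by auto
  moreover have "q ^ (h - 1) \<le> card (b ` J)" using False by (simp add: card_image[OF inj])
  ultimately obtain e where e: "\<And>i. i < h \<Longrightarrow> e i \<in> b ` J" "indep e h"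
    using exists_indep by blast
  define \<iota> where "\<iota> i = (SOME j. j \<in> J \<and> b j = e i)" for i
  have "\<iota> i \<in> J \<and> b (\<iota> i) = e i" if "i < h" for i
    unfolding \<iota>_def by (rule someI_ex) (use e(1)[OF that] in auto)
  hence \<iota>: "\<And>i. i < h \<Longrightarrow> \<iota> i \<in> J" "\<And>i. i < h \<Longrightarrow> b (\<iota> i) = e i" by blast+
  have e_nz: "e i \<noteq> 0" if "i < h" for i using \<iota>[OF that] nz[of "\<iota> i"] by simp
  define a' where "a' i = a (\<iota> i)" for i
  define c' where "c' i = c (\<iota> i)" for i
  have rel': "e i * qpoly p (c' i * x) = u (a' i * v x)" if "i < h" for i x
    using rel[OF \<iota>(1)[OF that]] \<iota>(2)[OF that] by (simp add: a'_def c'_def)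
  have comb: "u ((\<Sum>i<h. x i * a' i) * v z) = (\<Sum>i<h. x i * e i * qpoly p (c' i * z))"
    if "\<And>i. i < h \<Longrightarrow> x i \<in> F" for x z
  proof -
    have "u ((\<Sum>i<h. x i * a' i) * v z) = u (\<Sum>i<h. x i * (a' i * v z))"
      by (simp add: sum_distrib_right mult.assoc)
    also have "\<dots> = (\<Sum>i<h. x i * u (a' i * v z))"
      using that by (intro F_linear_map_sum[OF u(1)]) auto
    also have "\<dots> = (\<Sum>i<h. x i * e i * qpoly p (c' i * z))"
      using rel' by (simp add: mult.assoc)
    finally show ?thesis .
  qed
  have indep_a: "indep a' h"
    unfolding indep_def
  proof (intro allI impI)
    fix x i assume x: "\<forall>i<h. x i \<in> F" and eq: "(\<Sum>i<h. x i * a' i) = 0" and i: "i < h"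
    have "u 0 = 0" using F_linear_map_sum[OF u(1), of "{}"] by simp
    \<comment> \<open>The right-hand side is zero, written as a sum of the same shape so that the
      passage to traces applies.\<close>
    hence "(\<Sum>i<h. x i * e i * qpoly p (c' i * z)) = (\<Sum>i<h. 0 * qpoly p (0 * z))" for z
      using comb[where x = x and z = z] x eq by simp
    from full_qpoly_to_tr[OF assms(2) this]
    have "(\<Sum>i<h. x i * tr (c' i * y) * e i) = 0" for y
      by (simp add: mult_ac)
    moreover have "\<forall>i<h. x i * tr (c' i * y) \<in> F" for y
      using x by (auto intro: F_mult tr_in_F)
    ultimately have "x i * tr (c' i * y) = 0" for y
      using e(2)[unfolded indep_def, rule_format, of "\<lambda>i. x i * tr (c' i * y)" i] i by simp
    moreover have "c' i \<noteq> 0" using nz \<iota>(1)[OF i] by (simp add: c'_def)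
    ultimately show "x i = 0" using tr_nondegenerate[of "c' i"] by auto
  qed
  have "\<exists>i<h. \<exists>f\<in>F - {0}. b j = f * e i" if j: "j \<in> J" for j
  proof -
    obtain x where x: "\<And>i. i < h \<Longrightarrow> x i \<in> F" "a j = (\<Sum>i<h. x i * a' i)"
      using indep_expand[OF indep_a, where x = "a j"] by blast
    obtain y where y: "\<And>i. i < h \<Longrightarrow> y i \<in> F" "b j = (\<Sum>i<h. y i * e i)"
      using indep_expand[OF e(2), where x = "b j"] by blast
    have "(\<Sum>i<h. y i * e i * qpoly p (c j * z)) = (\<Sum>i<h. x i * e i * qpoly p (c' i * z))" for z
      using rel[OF j, of z] comb[OF x(1), where z = z] by (simp add: x(2) y(2) sum_distrib_right)
    from full_qpoly_to_tr[OF assms(2) this]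
    have "(\<Sum>i<h. (y i * tr (c j * z) - x i * tr (c' i * z)) * e i) = 0" for z
      by (simp add: left_diff_distrib right_diff_distrib sum_subtractf mult_ac)
    moreover have "\<forall>i<h. y i * tr (c j * z) - x i * tr (c' i * z) \<in> F" for z
      using x(1) y(1) by (auto intro!: F_mult tr_in_F F_diff)
    \<comment> \<open>The trace values lie in \<open>F\<close>, so independence of \<open>e\<close>
      splits the sum into one equation per basis member; nondegeneracy then removes the
      trace.\<close>
    ultimately have "\<forall>i<h. y i * tr (c j * z) - x i * tr (c' i * z) = 0" for z
      using e(2)[unfolded indep_def, rule_format, of "\<lambda>i. y i * tr (c j * z) - x i * tr (c' i * z)"]
      by simp
    hence "tr ((y i * c j - x i * c' i) * z) = 0" if "i < h" for i z
      using x(1) y(1) that by (simp add: left_diff_distrib tr_diff tr_scale mult.assoc)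
    hence cs: "y i * c j = x i * c' i" if "i < h" for i
      using tr_nondegenerate[of "y i * c j - x i * c' i"] that by simp
    have "\<exists>i<h. y i \<noteq> 0"
    proof (rule ccontr)
      assume "\<not> ?thesis"
      hence "b j = 0" unfolding y(2) by (intro sum.neutral) simp
      thus False using nz[OF j] by simp
    qed
    then obtain i where i: "i < h" "y i \<noteq> 0" by blast
    \<comment> \<open>The common ratio of \<open>c j\<close> to the basis value \<open>c' i\<close>,
      which lies in \<open>F\<close>.\<close>
    define f where "f = x i / y i"
    have f: "f \<in> F" "c j = f * c' i"
      using x(1) y(1) i cs[OF i(1)] by (auto simp: f_def field_simps intro: F_divide)
    have f0: "f \<noteq> 0" using f nz[OF j] by auto
    have a_nz: "a' i \<noteq> 0" using nz \<iota>(1)[OF i(1)] by (simp add: a'_def)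
    \<comment> \<open>As \<open>c j\<close> is an \<open>F\<close>-multiple of \<open>c' i\<close>,
      the relations for \<open>j\<close> and for the basis member involve the same value of
      \<open>qpoly p\<close>. Eliminating it leaves a scaling identity for \<open>u\<close> alone,
      to which non-monomiality applies.\<close>
    have "u (a j / a' i * z) = f * b j / e i * u z" for z
    proof -
      obtain z' where z': "z / a' i = v z'" using v by (metis surjD)
      have "u (a j / a' i * z) = u (a j * v z')" by (simp flip: z')
      also have "\<dots> = b j * qpoly p (f * (c' i * z'))" using rel[OF j, of z'] f by (simp add: mult.assoc)
      also have "qpoly p (f * (c' i * z')) = f * qpoly p (c' i * z')"
        using qpoly_linear f(1) by (simp add: F_linear_map_def)
      also have "qpoly p (c' i * z') = u (a' i * v z') / e i"
        using rel'[OF i(1), of z'] e_nz[OF i(1)] by (simp add: field_simps)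
      also have "a' i * v z' = z" using a_nz by (simp flip: z')
      finally show ?thesis by simp
    qed
    from not_monomial_scalar[OF h u this] have "f * b j / e i \<in> F" by simp
    hence "f * b j / e i / f \<in> F" using f(1) by (rule F_divide)
    hence "b j / e i \<in> F" using f0 by simp
    moreover have "b j = b j / e i * e i" using e_nz[OF i(1)] by simp
    moreover have "b j / e i \<noteq> 0" using e_nz[OF i(1)] nz[OF j] by simp
    ultimately show ?thesis using i(1) by blast
  qed
  hence "b ` J \<subseteq> (\<lambda>(i, f). f * e i) ` ({..<h} \<times> (F - {0}))" by force
  hence "card (b ` J) \<le> card ((\<lambda>(i, f). f * e i) ` ({..<h} \<times> (F - {0})))"
    by (intro card_mono) auto
  also have "\<dots> \<le> card ({..<h} \<times> (F - {0}))" by (intro card_image_le) auto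
  also have "\<dots> = h * (q - 1)" by (simp add: card_cartesian_product card_Diff_singleton card_F)
  finally show ?thesis by (simp add: card_image[OF inj])
qed

section \<open>\<open>F\<close>-linear bijections of the field and their inverses\<close>

definition lin_bij :: "('a \<Rightarrow> 'a) \<Rightarrow> bool" where
  "lin_bij f \<longleftrightarrow> bij f \<and> F_linear_map F f"

lemma lin_bij_add: "lin_bij f \<Longrightarrow> f (x + y) = f x + f y"
  by (simp add: lin_bij_def F_linear_map_def)

lemma lin_bij_zero: "lin_bij f \<Longrightarrow> f 0 = 0"
  unfolding lin_bij_def F_linear_map_def by (metis F_zero mult_zero_left)

lemma lin_bij_minus: "lin_bij f \<Longrightarrow> f (- x) = - f x"
  using lin_bij_add[of f x "- x"] by (simp add: lin_bij_zero eq_neg_iff_add_eq_0 add.commute)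

lemma lin_bij_diff: "lin_bij f \<Longrightarrow> f (x - y) = f x - f y"
  using lin_bij_add[of f x "- y"] by (simp add: lin_bij_minus)

lemma lin_bij_scale: "lin_bij f \<Longrightarrow> c \<in> F \<Longrightarrow> f (c * x) = c * f x"
  by (simp add: lin_bij_def F_linear_map_def)

lemma lin_bij_eq_iff: "lin_bij f \<Longrightarrow> f x = f y \<longleftrightarrow> x = y"
  by (auto simp: lin_bij_def bij_def inj_eq)

lemma lin_bij_eq_0_iff: "lin_bij f \<Longrightarrow> f x = 0 \<longleftrightarrow> x = 0"
  using lin_bij_eq_iff[of f x 0] by (simp add: lin_bij_zero)

lemma lin_bij_inv_right: "lin_bij f \<Longrightarrow> f (inv f x) = x"
  by (simp add: lin_bij_def bij_def surj_f_inv_f)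

lemma lin_bij_inv_left: "lin_bij f \<Longrightarrow> inv f (f x) = x"
  by (simp add: lin_bij_def bij_def inv_f_f)

lemma lin_bij_comp: "lin_bij f \<Longrightarrow> lin_bij g \<Longrightarrow> lin_bij (\<lambda>x. f (g x))"
  using bij_comp[of g f] by (simp add: lin_bij_def F_linear_map_def comp_def)

lemma lin_bij_inv:
  assumes "lin_bij f"
  shows "lin_bij (inv f)"
proof -
  have "inv f (x + y) = inv f x + inv f y" for x y
    by (subst lin_bij_eq_iff[OF assms, symmetric])
       (simp add: lin_bij_inv_right[OF assms] lin_bij_add[OF assms])
  moreover have "inv f (c * x) = c * inv f x" if "c \<in> F" for c x
    by (subst lin_bij_eq_iff[OF assms, symmetric])
       (simp add: lin_bij_inv_right[OF assms] lin_bij_scale[OF assms that])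
  moreover have "bij (inv f)" using assms by (simp add: lin_bij_def bij_imp_bij_inv)
  ultimately show ?thesis by (simp add: lin_bij_def F_linear_map_def)
qed

lemma lin_bijI:
  assumes "\<And>x y. f (x + y) = f x + f y" "\<And>c x. c \<in> F \<Longrightarrow> f (c * x) = c * f x"
    and "\<And>x. f x = 0 \<Longrightarrow> x = 0"
  shows "lin_bij f"
proof -
  have "inj f"
  proof (rule injI)
    fix x y assume "f x = f y"
    moreover have "f x = f (x - y) + f y" using assms(1)[of "x - y" y] by simp
    ultimately show "x = y" using assms(3)[of "x - y"] by simp
  qed
  hence "bij f" by (simp add: bij_def finite_UNIV_inj_surj)
  thus ?thesis using assms by (simp add: lin_bij_def F_linear_map_def)
qed

lemma lin_bij_frob: "lin_bij (\<lambda>x. x ^ (q ^ k))"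
  by (rule lin_bijI) (simp_all add: frob_add power_mult_distrib F_frob)

text \<open>The powers \<open>q ^ k\<close> and \<open>q ^ (h - k)\<close> undo each other, since
  their composite is \<open>x ^ (q ^ h) = x\<close>.\<close>

lemma monomial_inv:
  assumes "lin_bij f" "monomial f"
  shows "monomial (inv f)"
proof -
  obtain p k where k: "k < h" and f: "f = (\<lambda>x. p * x ^ (q ^ k))"
    using assms(2) by (auto simp: monomial_def)
  have p: "p \<noteq> 0" using lin_bij_eq_0_iff[OF assms(1), of 1] by (auto simp: f)
  define p' where "p' = inverse p ^ (q ^ (h - k))"
  have inv: "inv f y = p' * y ^ (q ^ (h - k))" for y
  proof (subst lin_bij_eq_iff[OF assms(1), symmetric])
    have "f (p' * y ^ (q ^ (h - k))) = p * ((inverse p * y) ^ (q ^ (h - k))) ^ (q ^ k)"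
      by (simp add: f p'_def power_mult_distrib)
    also have "((inverse p * y) ^ (q ^ (h - k))) ^ (q ^ k) = inverse p * y"
      unfolding frob_power using k by simp
    finally show "f (inv f y) = f (p' * y ^ (q ^ (h - k)))"
      using p by (simp add: lin_bij_inv_right[OF assms(1)])
  qed
  \<comment> \<open>For \<open>k = 0\<close> the index \<open>h - k\<close> is out of the range
    allowed by \<open>monomial\<close>, and index 0 gives the same power.\<close>
  show ?thesis
  proof (cases "k = 0")
    case True
    hence "inv f = (\<lambda>y. p' * y ^ (q ^ 0))" using inv by auto
    thus ?thesis using h_pos unfolding monomial_def by (intro exI[of _ p'] exI[of _ 0]) simp
  next
    case False
    hence "h - k < h" using k by simp
    moreover have "inv f = (\<lambda>y. p' * y ^ (q ^ (h - k)))" using inv by auto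
    ultimately show ?thesis unfolding monomial_def by blast
  qed
qed

lemma not_monomial_inv:
  assumes "lin_bij f" "\<not> monomial f"
  shows "\<not> monomial (inv f)"
  using monomial_inv[OF lin_bij_inv[OF assms(1)]] assms by (auto simp: lin_bij_def inv_inv_eq)

text \<open>Inverting the relation exchanges \<^term>\<open>t\<close> with its inverse, and one of the two has no vanishing
  coefficient.\<close>

lemma non_monomial_bound:
  assumes h: "h = 2 \<or> h = 3"
    and t: "lin_bij t" "\<not> monomial t" and u: "lin_bij u" "\<not> monomial u"
    and v: "lin_bij v" "\<not> monomial v"
    and J: "finite J" and nz: "\<And>j. j \<in> J \<Longrightarrow> a j \<noteq> 0 \<and> b j \<noteq> 0 \<and> c j \<noteq> 0"
    and inj: "inj_on b J" "inj_on c J"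
    and rel: "\<And>j x. j \<in> J \<Longrightarrow> b j * t (c j * x) = u (a j * v x)"
  shows "card J \<le> max (q ^ (h - 1) - 1) (h * (q - 1))"
proof -
  obtain p where p: "t = qpoly p" using F_linear_imp_qpoly t by (auto simp: lin_bij_def)
  obtain r where r: "inv t = qpoly r"
    using F_linear_imp_qpoly lin_bij_inv[OF t(1)] by (auto simp: lin_bij_def)
  have "qpoly p (qpoly r x) = x" for x
    unfolding p[symmetric] r[symmetric] by (rule lin_bij_inv_right[OF t(1)])
  hence "full p \<or> full r"
    using full_or_full_inverse[OF h, of p r] t(2) not_monomial_inv[OF t] by (simp add: p[symmetric] r[symmetric])
  thus ?thesis
  proof
    assume "full p"
    moreover have "F_linear_map F u" "surj v" using u v by (auto simp: lin_bij_def bij_def)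
    ultimately show ?thesis
      using full_bound[of p u v J a b c] h u(2) J nz inj(1) rel unfolding p by blast
  next
    assume "full r"
    moreover have "F_linear_map F (inv v)" "surj (inv u)"
      using lin_bij_inv[OF u(1)] lin_bij_inv[OF v(1)] by (auto simp: lin_bij_def bij_def)
    \<comment> \<open>In the inverted relation \<open>inverse (c j)\<close> takes the place of
      \<open>b j\<close>, and \<open>inv v\<close>, \<open>inv u\<close> those of \<open>u\<close>,
      \<open>v\<close>; hence injectivity of \<open>c\<close>.\<close>
    moreover have "inj_on (\<lambda>j. inverse (c j)) J"
      using inj(2) by (simp add: inj_on_def)
    moreover have "inverse (a j) \<noteq> 0 \<and> inverse (c j) \<noteq> 0 \<and> inverse (b j) \<noteq> 0" if "j \<in> J" for j
      using nz[OF that] by simp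
    moreover have "inverse (c j) * qpoly r (inverse (b j) * x) = inv v (inverse (a j) * inv u x)"
      if "j \<in> J" for j x
    proof -
      define z where "z = inv v (inverse (a j) * inv u x)"
      have "a j * v z = inv u x" using nz[OF that] by (simp add: z_def lin_bij_inv_right[OF v(1)])
      hence "b j * t (c j * z) = x" using rel[OF that, of z] by (simp add: lin_bij_inv_right[OF u(1)])
      hence "inverse (b j) * x = t (c j * z)" using nz[OF that] by auto
      hence "inv t (inverse (b j) * x) = c j * z" by (simp add: lin_bij_inv_left[OF t(1)])
      thus ?thesis using nz[OF that] unfolding r z_def[symmetric] by simp
    qed
    ultimately show ?thesis
      using full_bound[of r "inv v" "inv u" J "\<lambda>j. inverse (a j)" "\<lambda>j. inverse (c j)" "\<lambda>j. inverse (b j)"]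
        h not_monomial_inv[OF v] J by blast
  qed
qed

end

subsection \<open>Additive MDS codes of dimension three\<close>

locale additive_mds_code = subfield_extension F q h
  for F :: "'a::{finite,field} set" and q h :: nat +
  fixes C :: "'a list set" and n :: nat
  assumes F_linear_C: "F_linear_code F n C"
    and card_C: "card C = q ^ (3 * h)"
    and min_dist_C: "min_dist C = n - 2"
begin

section \<open>Codewords and their determination by three entries\<close>

lemma length_C: "x \<in> C \<Longrightarrow> length x = n"
  using F_linear_C by (auto simp: F_linear_code_def code_of_length_def)

lemma C_add:
  assumes "x \<in> C" "y \<in> C"
  obtains w where "w \<in> C" "\<And>j. j < n \<Longrightarrow> w ! j = x ! j + y ! j"
proof (rule that)
  show "map2 (+) x y \<in> C" using F_linear_C assms by (simp add: F_linear_code_def)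
qed (use assms length_C in simp)

lemma C_scale:
  assumes "x \<in> C" "c \<in> F"
  obtains w where "w \<in> C" "\<And>j. j < n \<Longrightarrow> w ! j = c * x ! j"
proof (rule that)
  show "map ((*) c) x \<in> C" using F_linear_C assms by (simp add: F_linear_code_def)
qed (use assms length_C in simp)

lemma C_diff:
  assumes "x \<in> C" "y \<in> C"
  obtains w where "w \<in> C" "\<And>j. j < n \<Longrightarrow> w ! j = x ! j - y ! j"
proof -
  obtain y' where y': "y' \<in> C" "\<And>j. j < n \<Longrightarrow> y' ! j = - 1 * y ! j"
    using C_scale[OF assms(2), of "- 1"] F_uminus[OF F_one] by blast
  obtain w where "w \<in> C" "\<And>j. j < n \<Longrightarrow> w ! j = x ! j + y' ! j"
    using C_add[OF assms(1) y'(1)] by blast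
  thus ?thesis using that[of w] y'(2) by simp
qed

text \<open>Distinct words agreeing in three positions would have distance at most
  \<open>n - 3\<close>, below the minimum distance.\<close>

lemma C_eqI:
  assumes "x \<in> C" "y \<in> C" "i < n" "k < n" "l < n" "distinct [i, k, l]"
    and "x ! i = y ! i" "x ! k = y ! k" "x ! l = y ! l"
  shows "x = y"
proof (rule ccontr)
  assume "x \<noteq> y"
  have fin: "finite C"
  proof (rule ccontr)
    assume "infinite C"
    thus False using card_C q_gt_1 by simp
  qed
  have "{hamming x y |x y. x \<in> C \<and> y \<in> C \<and> x \<noteq> y} \<subseteq> (\<lambda>(x, y). hamming x y) ` (C \<times> C)" by auto
  hence "finite {hamming x y |x y. x \<in> C \<and> y \<in> C \<and> x \<noteq> y}"
    by (rule finite_subset) (simp add: fin)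
  hence "min_dist C \<le> hamming x y"
    unfolding min_dist_def by (rule Min_le) (use assms(1,2) \<open>x \<noteq> y\<close> in blast)
  moreover have "hamming x y \<le> card ({..<n} - {i, k, l})"
    unfolding hamming_def using assms length_C by (intro card_mono) auto
  moreover have "card ({..<n} - {i, k, l}) = n - 3"
    using assms by (subst card_Diff_subset) auto
  \<comment> \<open>Subtraction is truncated, so \<open>n - 3 < n - 2\<close> requires this.\<close>
  moreover have "n \<ge> 3"
  proof -
    have "card {i, k, l} \<le> card {..<n}" using assms by (intro card_mono) auto
    thus ?thesis using assms(6) by simp
  qed
  ultimately show False using min_dist_C by linarith
qed

text \<open>Three entries determine a word, and there are as many words as triples of entries, so
  every triple occurs.\<close>

lemma C_word:
  assumes "i < n" "k < n" "l < n" "distinct [i, k, l]"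
  obtains w where "w \<in> C" "w ! i = x" "w ! k = y" "w ! l = z"
proof -
  have "inj_on (\<lambda>w. (w ! i, w ! k, w ! l)) C"
  proof (rule inj_onI)
    fix w w' assume "w \<in> C" "w' \<in> C" "(w ! i, w ! k, w ! l) = (w' ! i, w' ! k, w' ! l)"
    thus "w = w'" using assms by (intro C_eqI[of w w' i k l]) simp_all
  qed
  hence "card ((\<lambda>w. (w ! i, w ! k, w ! l)) ` C) = q ^ (3 * h)"
    by (simp add: card_image card_C)
  also have "\<dots> = card (UNIV :: ('a \<times> 'a \<times> 'a) set)"
    unfolding UNIV_Times_UNIV[symmetric] card_cartesian_product card_UNIV_eq
    by (simp add: numeral_3_eq_3 power_add mult.assoc)
  finally have "(\<lambda>w. (w ! i, w ! k, w ! l)) ` C = UNIV" by (intro card_subset_eq) simp_all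
  hence "(x, y, z) \<in> (\<lambda>w. (w ! i, w ! k, w ! l)) ` C" by simp
  thus ?thesis using that by auto
qed

section \<open>Scalars coming from linear projections\<close>

text \<open>Pulls the equivalence back to the coordinates of \<open>C\<close>: after the changes of
  variable \<theta>, the words vanishing at \<open>i\<close> admit multiplication by every field
  element, not only by those of \<open>F\<close>.\<close>

lemma linear_projection:
  assumes "i < n" "linear_code (n - 1) D" "F_equiv F (n - 1) (proj i C) D"
  obtains \<theta> where "\<And>j. j < n \<Longrightarrow> j \<noteq> i \<Longrightarrow> lin_bij (\<theta> j)"
    and "\<And>x \<mu>. x \<in> C \<Longrightarrow> x ! i = 0 \<Longrightarrow>
      \<exists>y\<in>C. y ! i = 0 \<and> (\<forall>j<n. j \<noteq> i \<longrightarrow> \<theta> j (y ! j) = \<mu> * \<theta> j (x ! j))"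
proof -
  obtain \<sigma> \<phi> where \<sigma>: "bij_betw \<sigma> {..<n-1} {..<n-1}"
    and \<phi>: "\<And>j. j < n - 1 \<Longrightarrow> bij (\<phi> j) \<and> F_linear_map F (\<phi> j)"
    and D: "D = (\<lambda>x. map (\<lambda>j. \<phi> j (x ! \<sigma> j)) [0..<n-1]) ` proj i C"
    using assms(3) unfolding F_equiv_def by blast
  \<comment> \<open>\<tau> undoes the permutation, and \<open>s\<close> renumbers the coordinates
    once position \<open>i\<close> is deleted.\<close>
  define \<tau> where "\<tau> = inv_into {..<n-1} \<sigma>"
  define s where "s j = (if j < i then j else j - 1)" for j
  define pr where "pr x = take i x @ drop (Suc i) x" for x :: "'a list"
  have s: "s j < n - 1" if "j < n" "j \<noteq> i" for j using that assms(1) by (auto simp: s_def)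
  have pr: "pr x ! s j = x ! j" if "x \<in> C" "j < n" "j \<noteq> i" for x j
    using that assms(1) length_C[OF that(1)] by (auto simp: s_def pr_def nth_append min_def)
  have \<tau>: "\<tau> k < n - 1" "\<sigma> (\<tau> k) = k" if "k < n - 1" for k
    using \<sigma> that unfolding \<tau>_def
    by (metis bij_betw_imp_surj_on inv_into_into lessThan_iff)
       (metis \<sigma> bij_betw_imp_surj_on f_inv_into_f lessThan_iff that)
  define \<theta> where "\<theta> j = \<phi> (\<tau> (s j))" for j
  show ?thesis
  proof (rule that[of \<theta>])
    fix j assume "j < n" "j \<noteq> i"
    thus "lin_bij (\<theta> j)" using \<phi> \<tau> s by (simp add: \<theta>_def lin_bij_def)
  next
    fix x \<mu> assume x: "x \<in> C" "x ! i = 0"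
    define enc where "enc w = map (\<lambda>j. \<phi> j (pr w ! \<sigma> j)) [0..<n-1]" for w
    have D': "D = enc ` {w \<in> C. w ! i = 0}"
      unfolding D proj_def enc_def pr_def by auto
    hence "enc x \<in> D" using x by blast
    hence "map ((*) \<mu>) (enc x) \<in> D"
      using assms(2) unfolding linear_code_def F_linear_code_def by blast
    then obtain y where y: "y \<in> C" "y ! i = 0" "map ((*) \<mu>) (enc x) = enc y"
      unfolding D' by auto
    have "\<theta> j (y ! j) = \<mu> * \<theta> j (x ! j)" if j: "j < n" "j \<noteq> i" for j
    proof -
      have "enc y ! \<tau> (s j) = \<mu> * enc x ! \<tau> (s j)"
        using \<tau>(1)[OF s[OF j]] by (simp flip: y(3)) (simp add: enc_def)
      thus ?thesis
        using \<tau>[OF s[OF j]] pr[OF x(1) j] pr[OF y(1) j] by (simp add: enc_def \<theta>_def)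
    qed
    thus "\<exists>y\<in>C. y ! i = 0 \<and> (\<forall>j<n. j \<noteq> i \<longrightarrow> \<theta> j (y ! j) = \<mu> * \<theta> j (x ! j))"
      using y by blast
  qed
qed

text \<open>The words vanishing at \<open>i\<close> and \<open>l\<close> are, after \<theta>, the
  field multiples of a single word \<open>e\<close>, so any two of their entries are
  proportional.\<close>

lemma projection_scalars:
  assumes "i < n" "k < n" "l < n" "j < n" "distinct [i, k, l]" "j \<notin> {i, k, l}"
    and \<theta>: "\<And>j. j < n \<Longrightarrow> j \<noteq> i \<Longrightarrow> lin_bij (\<theta> j)"
    and scale: "\<And>x \<mu>. x \<in> C \<Longrightarrow> x ! i = 0 \<Longrightarrow>
      \<exists>y\<in>C. y ! i = 0 \<and> (\<forall>j<n. j \<noteq> i \<longrightarrow> \<theta> j (y ! j) = \<mu> * \<theta> j (x ! j))"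
  obtains \<beta> where "\<beta> \<noteq> 0"
    "\<And>x. x \<in> C \<Longrightarrow> x ! i = 0 \<Longrightarrow> x ! l = 0 \<Longrightarrow> \<theta> j (x ! j) = \<beta> * \<theta> k (x ! k)"
proof -
  have bij: "lin_bij (\<theta> j)" "lin_bij (\<theta> k)" "lin_bij (\<theta> l)" using assms by auto
  \<comment> \<open>Normalised to have entry 1 at \<open>k\<close> after \<theta>, so that the
    multiple by \<open>\<theta> k (x ! k)\<close> reproduces \<open>x\<close> at
    \<open>k\<close>.\<close>
  obtain e where e: "e \<in> C" "e ! i = 0" "e ! k = inv (\<theta> k) 1" "e ! l = 0"
    using C_word[OF assms(1-3,5)] .
  show ?thesis
  proof (rule that)
    show "\<theta> j (e ! j) \<noteq> 0"
    proof
      assume "\<theta> j (e ! j) = 0"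
      hence "e ! j = 0" by (simp add: lin_bij_eq_0_iff[OF bij(1)])
      moreover obtain z where z: "z \<in> C" "z ! i = 0" "z ! k = 0" "z ! l = 0"
        using C_word[OF assms(1-3,5)] .
      \<comment> \<open>\<open>d\<close> is the zero word; \<open>e\<close> would agree with it at
        \<open>i\<close>, \<open>l\<close> and \<open>j\<close>.\<close>
      moreover obtain d where d: "d \<in> C" "\<And>j. j < n \<Longrightarrow> d ! j = z ! j - z ! j"
        using C_diff[OF z(1) z(1)] by blast
      ultimately have "e = d"
        using e assms by (intro C_eqI[of _ _ i l j]) auto
      hence "inv (\<theta> k) 1 = 0" using d(2)[OF assms(2)] e(3) by simp
      hence "\<theta> k 0 = 1" using lin_bij_inv_right[OF bij(2), of 1] by simp
      thus False by (simp add: lin_bij_zero[OF bij(2)])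
    qed
  next
    fix x assume x: "x \<in> C" "x ! i = 0" "x ! l = 0"
    obtain y where y: "y \<in> C" "y ! i = 0" "\<And>j. j < n \<Longrightarrow> j \<noteq> i \<Longrightarrow> \<theta> j (y ! j) = \<theta> k (x ! k) * \<theta> j (e ! j)"
      using scale[OF e(1,2), of "\<theta> k (x ! k)"] by blast
    have "y ! l = 0"
      using y(3)[of l] assms e(4) by (simp add: lin_bij_zero[OF bij(3)] lin_bij_eq_0_iff[OF bij(3)])
    moreover have "y ! k = x ! k"
      using y(3)[of k] assms e(3) by (simp add: lin_bij_inv_right[OF bij(2)] lin_bij_eq_iff[OF bij(2)])
    ultimately have "y = x" using x y assms by (intro C_eqI[of _ _ i k l]) auto
    thus "\<theta> j (x ! j) = \<theta> j (e ! j) * \<theta> k (x ! k)"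
      using y(3)[of j] assms by simp
  qed
qed

text \<open>On words vanishing at \<open>i\<close>, entry \<open>j\<close> becomes a linear form in
  the entries at \<open>k\<close> and \<open>l\<close>, with nonzero coefficients \<beta> and
  \<gamma>; setting it to zero gives the ratio \<open>- (\<beta> / \<gamma>)\<close>.\<close>

lemma projection_relation:
  assumes pos: "i < n" "k < n" "l < n" "distinct [i, k, l]" and J: "J = {..<n} - {i, k, l}"
    and lin: "linear_code (n - 1) D" "F_equiv F (n - 1) (proj i C) D"
  obtains P R m where "lin_bij P" "lin_bij R" "\<And>j. j \<in> J \<Longrightarrow> m j \<noteq> 0" "inj_on m J"
    "\<And>j x. j \<in> J \<Longrightarrow> x \<in> C \<Longrightarrow> x ! i = 0 \<Longrightarrow> x ! j = 0 \<Longrightarrow> P (x ! l) = m j * R (x ! k)"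
proof -
  obtain \<theta> where bij: "\<And>j. j < n \<Longrightarrow> j \<noteq> i \<Longrightarrow> lin_bij (\<theta> j)"
    and scale: "\<And>x \<mu>. x \<in> C \<Longrightarrow> x ! i = 0 \<Longrightarrow>
      \<exists>y\<in>C. y ! i = 0 \<and> (\<forall>j<n. j \<noteq> i \<longrightarrow> \<theta> j (y ! j) = \<mu> * \<theta> j (x ! j))"
    using linear_projection[OF pos(1) lin] by metis
  have bij_kl: "lin_bij (\<theta> k)" "lin_bij (\<theta> l)" using bij pos by auto
  have "\<exists>m. m \<noteq> 0 \<and> (\<forall>x\<in>C. x ! i = 0 \<longrightarrow> x ! j = 0 \<longrightarrow> \<theta> l (x ! l) = m * \<theta> k (x ! k))"
    if j: "j \<in> J" for j
  proof -
    have bij_j: "lin_bij (\<theta> j)" using bij J j by auto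
    obtain \<beta> where \<beta>: "\<beta> \<noteq> 0"
      "\<And>x. x \<in> C \<Longrightarrow> x ! i = 0 \<Longrightarrow> x ! l = 0 \<Longrightarrow> \<theta> j (x ! j) = \<beta> * \<theta> k (x ! k)"
      using projection_scalars[of i k l j \<theta>] pos J j bij scale by auto
    obtain \<gamma> where \<gamma>: "\<gamma> \<noteq> 0"
      "\<And>x. x \<in> C \<Longrightarrow> x ! i = 0 \<Longrightarrow> x ! k = 0 \<Longrightarrow> \<theta> j (x ! j) = \<gamma> * \<theta> l (x ! l)"
      using projection_scalars[of i l k j \<theta>] pos J j bij scale by auto
    have "\<theta> l (x ! l) = - (\<beta> / \<gamma>) * \<theta> k (x ! k)" if x: "x \<in> C" "x ! i = 0" "x ! j = 0" for x
    proof -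
      \<comment> \<open>Splits \<open>x\<close> into \<open>y\<close>, which vanishes at
        \<open>l\<close>, and \<open>x - y\<close>, which vanishes at \<open>k\<close>.\<close>
      obtain y where y: "y \<in> C" "y ! i = 0" "y ! k = x ! k" "y ! l = 0"
        using C_word[OF pos] .
      obtain d where d: "d \<in> C" "\<And>j. j < n \<Longrightarrow> d ! j = x ! j - y ! j"
        using C_diff[OF x(1) y(1)] by blast
      have "\<theta> j (d ! j) = \<gamma> * \<theta> l (x ! l)"
        using \<gamma>(2)[OF d(1)] d(2) x y pos by simp
      moreover have "\<theta> j (d ! j) = - (\<beta> * \<theta> k (x ! k))"
        using \<beta>(2)[OF y(1)] d(2) x y J j by (simp add: lin_bij_minus[OF bij_j])
      ultimately show ?thesis using \<gamma>(1) by (simp add: field_simps)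
    qed
    moreover have "- (\<beta> / \<gamma>) \<noteq> 0" using \<beta>(1) \<gamma>(1) by simp
    ultimately show ?thesis by blast
  qed
  then obtain m where m: "\<And>j. j \<in> J \<Longrightarrow> m j \<noteq> 0"
    "\<And>j x. j \<in> J \<Longrightarrow> x \<in> C \<Longrightarrow> x ! i = 0 \<Longrightarrow> x ! j = 0 \<Longrightarrow> \<theta> l (x ! l) = m j * \<theta> k (x ! k)"
    by metis
  \<comment> \<open>Equal multipliers at \<open>j\<close> and \<open>j'\<close> would give a nonzero
    word vanishing at \<open>i\<close>, \<open>j\<close> and \<open>j'\<close>.\<close>
  have "inj_on m J"
  proof (rule inj_onI, rule ccontr)
    fix j j' assume j: "j \<in> J" "j' \<in> J" "m j = m j'" "j \<noteq> j'"
    have ikj: "distinct [i, k, j]" "distinct [i, k, j']" "j < n" "j' < n" using j J pos by auto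
    obtain x where x: "x \<in> C" "x ! i = 0" "x ! k = 1" "x ! j = 0"
      using C_word[OF pos(1,2) ikj(3,1)] .
    obtain y where y: "y \<in> C" "y ! i = 0" "y ! k = 1" "y ! j' = 0"
      using C_word[OF pos(1,2) ikj(4,2)] .
    have "\<theta> l (x ! l) = \<theta> l (y ! l)"
      using m(2)[OF j(1) x(1,2,4)] m(2)[OF j(2) y(1,2,4)] j(3) x(3) y(3) by simp
    hence "x ! l = y ! l" by (simp add: lin_bij_eq_iff[OF bij_kl(2)])
    hence "x = y" using x y pos by (intro C_eqI[of _ _ i k l]) auto
    obtain d where d: "d \<in> C" "\<And>j. j < n \<Longrightarrow> d ! j = x ! j - x ! j"
      using C_diff[OF x(1) x(1)] by blast
    have "x = d" using x y \<open>x = y\<close> d pos ikj j(4) by (intro C_eqI[of _ _ i j j']) auto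
    thus False using d(2)[OF pos(2)] x(3) by simp
  qed
  thus ?thesis using that[of "\<theta> l" "\<theta> k" m] bij_kl m by blast
qed

text \<open>With the changes of variable at \<open>i\<close>, \<open>k\<close>, \<open>l\<close>
  fixed once for all \<open>j\<close>, every further entry becomes a field-linear form in these
  three, so the transformed code is linear.\<close>

lemma linear_equivI:
  assumes pos: "i < n" "k < n" "l < n" "distinct [i, k, l]" and J: "J = {..<n} - {i, k, l}"
    and bij: "lin_bij \<psi>1" "lin_bij \<psi>2" "lin_bij \<psi>3"
    and rel1: "\<And>j x. j \<in> J \<Longrightarrow> x \<in> C \<Longrightarrow> x ! k = 0 \<Longrightarrow> x ! j = 0 \<Longrightarrow> \<psi>3 (x ! l) = a j * \<psi>1 (x ! i)"
    and rel2: "\<And>j x. j \<in> J \<Longrightarrow> x \<in> C \<Longrightarrow> x ! i = 0 \<Longrightarrow> x ! j = 0 \<Longrightarrow> \<psi>3 (x ! l) = b j * \<psi>2 (x ! k)"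
  shows "\<exists>D. linear_code n D \<and> F_equiv F n C D"
proof -
  have "\<exists>\<psi>. lin_bij \<psi> \<and> (\<exists>\<alpha> \<beta> \<gamma>.
      \<forall>x\<in>C. \<psi> (x ! j) = \<alpha> * \<psi>1 (x ! i) + \<beta> * \<psi>2 (x ! k) + \<gamma> * \<psi>3 (x ! l))"
    (is "\<exists>\<psi>. lin_bij \<psi> \<and> ?comb j \<psi>") if "j < n" for j
  proof -
    have "j = i \<or> j = k \<or> j = l \<or> j \<in> J" unfolding J using that by auto
    then consider "j = i" | "j = k" | "j = l" | "j \<in> J" by blast
    thus ?thesis
    proof cases
      case 1
      have "\<forall>x\<in>C. \<psi>1 (x ! j) = 1 * \<psi>1 (x ! i) + 0 * \<psi>2 (x ! k) + 0 * \<psi>3 (x ! l)"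
        using 1 by simp
      thus ?thesis using bij(1) by blast
    next
      case 2
      have "\<forall>x\<in>C. \<psi>2 (x ! j) = 0 * \<psi>1 (x ! i) + 1 * \<psi>2 (x ! k) + 0 * \<psi>3 (x ! l)"
        using 2 by simp
      thus ?thesis using bij(2) by blast
    next
      case 3
      have "\<forall>x\<in>C. \<psi>3 (x ! j) = 0 * \<psi>1 (x ! i) + 0 * \<psi>2 (x ! k) + 1 * \<psi>3 (x ! l)"
        using 3 by simp
      thus ?thesis using bij(3) by blast
    next
      case 4
      \<comment> \<open>The unique word with entries 0, 0, \<open>z\<close> at \<open>i\<close>,
        \<open>k\<close>, \<open>l\<close>. Its entry at \<open>j\<close> depends bijectively on
        \<open>z\<close>, which supplies the change of variable at \<open>j\<close>.\<close>
      define W where "W z = (SOME w. w \<in> C \<and> w ! i = 0 \<and> w ! k = 0 \<and> w ! l = z)" for z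
      have W: "W z \<in> C \<and> W z ! i = 0 \<and> W z ! k = 0 \<and> W z ! l = z" for z
        unfolding W_def by (rule someI_ex) (use C_word[OF pos, of 0 0 z] in blast)
      have W_eq: "w = W (w ! l)" if "w \<in> C" "w ! i = 0" "w ! k = 0" for w
        using that pos W[of "w ! l"] by (intro C_eqI[of _ _ i k l]) auto
      define g where "g z = W z ! j" for z
      have j: "j < n" "j \<noteq> i" "j \<noteq> k" "j \<noteq> l" using 4 J by auto
      have "lin_bij g"
      proof (rule lin_bijI)
        fix x y
        obtain w where w: "w \<in> C" "\<And>j. j < n \<Longrightarrow> w ! j = W x ! j + W y ! j"
          using C_add[of "W x" "W y"] W by blast
        hence "w = W (x + y)" using W_eq[of w] W pos by simp
        thus "g (x + y) = g x + g y" using w(2)[OF j(1)] by (simp add: g_def)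
      next
        fix c x assume "c \<in> F"
        then obtain w where w: "w \<in> C" "\<And>j. j < n \<Longrightarrow> w ! j = c * W x ! j"
          using C_scale[of "W x" c] W by blast
        hence "w = W (c * x)" using W_eq[of w] W pos by simp
        thus "g (c * x) = c * g x" using w(2)[OF j(1)] by (simp add: g_def)
      next
        fix x assume x: "g x = 0"
        obtain d where d: "d \<in> C" "\<And>j. j < n \<Longrightarrow> d ! j = W x ! j - W x ! j"
          using C_diff[of "W x" "W x"] W by blast
        have "W x = d" using d W x j pos by (intro C_eqI[of _ _ i k j]) (auto simp: g_def)
        thus "x = 0" using d(2)[OF pos(3)] W[of x] by simp
      qed
      note g = this
      \<comment> \<open>Decompose \<open>x\<close> as \<open>W z + y + y'\<close>:
        \<open>W z\<close> carries the whole entry at \<open>j\<close>, while \<open>y\<close> and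
        \<open>y'\<close> vanish at \<open>j\<close> and obey the two given relations.\<close>
      have "\<psi>3 (inv g (x ! j)) = - a j * \<psi>1 (x ! i) + - b j * \<psi>2 (x ! k) + 1 * \<psi>3 (x ! l)"
        if x: "x \<in> C" for x
      proof -
        define z where "z = inv g (x ! j)"
        have Wj: "W z ! j = x ! j" using lin_bij_inv_right[OF g] by (simp add: z_def flip: g_def)
        obtain d where d: "d \<in> C" "\<And>j. j < n \<Longrightarrow> d ! j = x ! j - W z ! j"
          using C_diff[of x "W z"] x W by blast
        have kij: "distinct [k, i, j]" using pos j by auto
        obtain y where y: "y \<in> C" "y ! k = 0" "y ! i = x ! i" "y ! j = 0"
          using C_word[OF pos(2,1) j(1) kij] .
        obtain y' where y': "y' \<in> C" "\<And>j. j < n \<Longrightarrow> y' ! j = d ! j - y ! j"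
          using C_diff[OF d(1) y(1)] by blast
        have "y' ! i = 0" "y' ! j = 0" "y' ! k = x ! k"
          using y' d y W[of z] Wj pos j by auto
        hence "\<psi>3 (y' ! l) = b j * \<psi>2 (x ! k)" using rel2[OF 4 y'(1)] by simp
        moreover have "\<psi>3 (y ! l) = a j * \<psi>1 (x ! i)" using rel1[OF 4 y(1)] y by simp
        moreover have "x ! l - z = y' ! l + y ! l" using y'(2) d(2) W[of z] pos by simp
        hence "\<psi>3 (x ! l) - \<psi>3 z = \<psi>3 (y' ! l) + \<psi>3 (y ! l)"
          by (simp flip: lin_bij_diff[OF bij(3)] lin_bij_add[OF bij(3)])
        ultimately show ?thesis by (simp add: z_def algebra_simps)
      qed
      thus ?thesis using lin_bij_comp[OF bij(3) lin_bij_inv[OF g]] by blast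
    qed
  qed
  hence "\<forall>j. \<exists>\<psi>. j < n \<longrightarrow> lin_bij \<psi> \<and> ?comb j \<psi>" by blast
  from choice[OF this] obtain \<psi> where "\<forall>j. j < n \<longrightarrow> lin_bij (\<psi> j) \<and> ?comb j (\<psi> j)" ..
  hence \<psi>: "\<And>j. j < n \<Longrightarrow> lin_bij (\<psi> j)" and comb: "\<And>j. j < n \<Longrightarrow> ?comb j (\<psi> j)" by blast+
  define enc where "enc x = map (\<lambda>j. \<psi> j (x ! j)) [0..<n]" for x
  have "F_equiv F n C (enc ` C)"
    unfolding F_equiv_def enc_def
    by (rule exI[of _ id], rule exI[of _ \<psi>]) (use \<psi> in \<open>auto simp: lin_bij_def\<close>)
  moreover have "linear_code n (enc ` C)"
    unfolding linear_code_def F_linear_code_def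
  proof (intro conjI ballI)
    show "code_of_length n (enc ` C)" by (auto simp: code_of_length_def enc_def)
  next
    have "replicate n 0 \<in> C" using F_linear_C by (simp add: F_linear_code_def)
    moreover have "enc (replicate n 0) = replicate n 0"
      by (rule nth_equalityI) (auto simp: enc_def lin_bij_zero[OF \<psi>])
    ultimately show "replicate n 0 \<in> enc ` C" by (metis imageI)
  next
    fix x y assume "x \<in> enc ` C" "y \<in> enc ` C"
    then obtain x' y' where x': "x' \<in> C" "x = enc x'" and y': "y' \<in> C" "y = enc y'" by blast
    obtain w where w: "w \<in> C" "\<And>j. j < n \<Longrightarrow> w ! j = x' ! j + y' ! j"
      using C_add[OF x'(1) y'(1)] by blast
    have "map2 (+) x y = enc w"
      by (rule nth_equalityI) (auto simp: x' y' enc_def w(2) lin_bij_add[OF \<psi>])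
    thus "map2 (+) x y \<in> enc ` C" using w(1) by blast
  next
    fix \<mu> x assume "x \<in> enc ` C"
    then obtain x' where x': "x' \<in> C" "x = enc x'" by blast
    \<comment> \<open>The candidate for the multiple by \<mu>, prescribed at \<open>i\<close>,
      \<open>k\<close>, \<open>l\<close>; the linear forms propagate the scaling to all other
      entries.\<close>
    obtain w where w: "w \<in> C" "w ! i = inv \<psi>1 (\<mu> * \<psi>1 (x' ! i))"
      "w ! k = inv \<psi>2 (\<mu> * \<psi>2 (x' ! k))" "w ! l = inv \<psi>3 (\<mu> * \<psi>3 (x' ! l))"
      using C_word[OF pos] .
    have "\<psi> j (w ! j) = \<mu> * \<psi> j (x' ! j)" if j: "j < n" for j
    proof -
      obtain \<alpha> \<beta> \<gamma> where coord:
        "\<And>x. x \<in> C \<Longrightarrow> \<psi> j (x ! j) = \<alpha> * \<psi>1 (x ! i) + \<beta> * \<psi>2 (x ! k) + \<gamma> * \<psi>3 (x ! l)"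
        using comb[OF j] by blast
      show ?thesis
        unfolding coord[OF w(1)] coord[OF x'(1)] w(2-4)
        by (simp add: lin_bij_inv_right bij algebra_simps)
    qed
    hence "map ((*) \<mu>) x = enc w"
      by (intro nth_equalityI) (auto simp: x' enc_def)
    thus "map ((*) \<mu>) x \<in> enc ` C" using w(1) by blast
  qed
  ultimately show ?thesis by blast
qed

text \<open>The projections normalise each special coordinate twice. If two normalisations agree up
  to a scalar and a Frobenius power, they can be merged to meet \<open>linear_equivI\<close>;
  otherwise the bound on triples contradicts the length.\<close>

lemma linear_if_three_projections_linear:
  assumes h: "h = 2 \<or> h = 3" and n: "n > max (q ^ (h - 1) - 1) (h * (q - 1)) + 3"
    and pos: "i < n" "k < n" "l < n" "distinct [i, k, l]"
    and lin: "\<And>m. m \<in> {i, k, l} \<Longrightarrow> \<exists>D. linear_code (n - 1) D \<and> F_equiv F (n - 1) (proj m C) D"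
  shows "\<exists>D. linear_code n D \<and> F_equiv F n C D"
proof -
  define J where "J = {..<n} - {i, k, l}"
  have perm: "distinct [k, i, l]" "J = {..<n} - {k, i, l}" "distinct [l, i, k]" "J = {..<n} - {l, i, k}"
    using pos J_def by auto
  have card_J: "card J = n - 3"
    unfolding J_def using pos by (subst card_Diff_subset) auto
  obtain D1 where "linear_code (n - 1) D1" "F_equiv F (n - 1) (proj i C) D1" using lin by blast
  then obtain P1 R1 b where R1: "lin_bij P1" "lin_bij R1" "\<And>j. j \<in> J \<Longrightarrow> b j \<noteq> 0" "inj_on b J"
    and rel1: "\<And>j x. j \<in> J \<Longrightarrow> x \<in> C \<Longrightarrow> x ! i = 0 \<Longrightarrow> x ! j = 0 \<Longrightarrow> P1 (x ! l) = b j * R1 (x ! k)"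
    by (rule projection_relation[OF pos J_def]) blast
  obtain D2 where "linear_code (n - 1) D2" "F_equiv F (n - 1) (proj k C) D2" using lin by blast
  then obtain P2 R2 a where R2: "lin_bij P2" "lin_bij R2" "\<And>j. j \<in> J \<Longrightarrow> a j \<noteq> 0" "inj_on a J"
    and rel2: "\<And>j x. j \<in> J \<Longrightarrow> x \<in> C \<Longrightarrow> x ! k = 0 \<Longrightarrow> x ! j = 0 \<Longrightarrow> P2 (x ! l) = a j * R2 (x ! i)"
    by (rule projection_relation[OF pos(2,1,3) perm(1,2)]) blast
  obtain D3 where "linear_code (n - 1) D3" "F_equiv F (n - 1) (proj l C) D3" using lin by blast
  then obtain P3 R3 c where R3: "lin_bij P3" "lin_bij R3" "\<And>j. j \<in> J \<Longrightarrow> c j \<noteq> 0" "inj_on c J"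
    and rel3: "\<And>j x. j \<in> J \<Longrightarrow> x \<in> C \<Longrightarrow> x ! l = 0 \<Longrightarrow> x ! j = 0 \<Longrightarrow> P3 (x ! k) = c j * R3 (x ! i)"
    by (rule projection_relation[OF pos(3,1,2) perm(3,4)]) blast
  \<comment> \<open>\<open>t\<close>, \<open>u\<close> and \<open>v\<close> compare the two
    normalisations of coordinates \<open>k\<close>, \<open>l\<close> and \<open>i\<close>
    respectively.\<close>
  define t where "t = (\<lambda>x. R1 (inv P3 x))"
  define u where "u = (\<lambda>x. P1 (inv P2 x))"
  define v where "v = (\<lambda>x. R2 (inv R3 x))"
  have t: "lin_bij t" unfolding t_def using R1(2) lin_bij_inv[OF R3(1)] by (rule lin_bij_comp)
  have u: "lin_bij u" unfolding u_def using R1(1) lin_bij_inv[OF R2(1)] by (rule lin_bij_comp)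
  have v: "lin_bij v" unfolding v_def using R2(2) lin_bij_inv[OF R3(2)] by (rule lin_bij_comp)
  \<comment> \<open>With equal entries at \<open>i\<close>, the difference of a word vanishing at
    \<open>l\<close>, \<open>j\<close> and one vanishing at \<open>k\<close>, \<open>j\<close>
    vanishes at \<open>i\<close>, \<open>j\<close>, so all three relations meet. The sign comes from
    \<open>d ! k = - y ! k\<close>.\<close>
  have rel: "- b j * t (c j * x) = u (a j * v x)" if j: "j \<in> J" for j x
  proof -
    have j': "j < n" "distinct [i, l, j]" "distinct [i, k, j]" using j pos by (auto simp: J_def)
    obtain y where y: "y \<in> C" "y ! i = inv R3 x" "y ! l = 0" "y ! j = 0"
      using C_word[OF pos(1,3) j'(1,2)] .
    obtain z where z: "z \<in> C" "z ! i = inv R3 x" "z ! k = 0" "z ! j = 0"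
      using C_word[OF pos(1,2) j'(1,3)] .
    obtain d where d: "d \<in> C" "\<And>j. j < n \<Longrightarrow> d ! j = z ! j - y ! j"
      using C_diff[OF z(1) y(1)] by blast
    have "P3 (y ! k) = c j * x"
      using rel3[OF j y(1,3,4)] by (simp add: y lin_bij_inv_right[OF R3(2)])
    hence yk: "R1 (y ! k) = t (c j * x)"
      unfolding t_def by (metis lin_bij_inv_left[OF R3(1)])
    have "P2 (z ! l) = a j * v x" using rel2[OF j z(1,3,4)] by (simp add: z v_def)
    hence zl: "P1 (z ! l) = u (a j * v x)"
      unfolding u_def by (metis lin_bij_inv_left[OF R2(1)])
    have "P1 (d ! l) = b j * R1 (d ! k)" using d y z pos j' by (intro rel1[OF j]) auto
    thus ?thesis using d(2) y z pos yk zl by (simp add: lin_bij_minus[OF R1(2)])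
  qed
  have "monomial t \<or> monomial u \<or> monomial v"
  proof (rule ccontr)
    assume neg: "\<not> ?thesis"
    have "inj_on (\<lambda>j. - b j) J" using R1(4) by (simp add: inj_on_def)
    moreover have "a j \<noteq> 0 \<and> - b j \<noteq> 0 \<and> c j \<noteq> 0" if "j \<in> J" for j
      using R1(3) R2(3) R3(3) that by simp
    moreover have "finite J" by (simp add: J_def)
    ultimately have "card J \<le> max (q ^ (h - 1) - 1) (h * (q - 1))"
      using non_monomial_bound[of t u v J a "\<lambda>j. - b j" c] h t u v R3(4) rel neg by blast
    thus False using n card_J by linarith
  qed
  thus ?thesis
  proof (elim disjE)
    assume "monomial t"
    then obtain p m where m: "t = (\<lambda>x. p * x ^ (q ^ m))" by (auto simp: monomial_def)
    show ?thesis
    \<comment> \<open>Coordinate \<open>i\<close> uses \<open>R3\<close> followed by Frobenius,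
      because \<open>u (a j * v x)\<close> equals \<open>- b j * t (c j * x)\<close>.\<close>
    proof (rule linear_equivI[OF pos J_def lin_bij_comp[OF lin_bij_frob[of m] R3(2)] R1(2,1) _ rel1])
      fix j x assume j: "j \<in> J" and x: "x \<in> C" "x ! k = 0" "x ! j = 0"
      have "P1 (x ! l) = u (P2 (x ! l))" by (simp add: u_def lin_bij_inv_left[OF R2(1)])
      also have "\<dots> = u (a j * v (R3 (x ! i)))"
        unfolding rel2[OF j x] by (simp add: v_def lin_bij_inv_left[OF R3(2)])
      also have "\<dots> = - b j * p * c j ^ (q ^ m) * R3 (x ! i) ^ (q ^ m)"
        unfolding rel[OF j, symmetric] by (simp add: m power_mult_distrib)
      finally show "P1 (x ! l) = - b j * p * c j ^ (q ^ m) * R3 (x ! i) ^ (q ^ m)" .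
    qed
  next
    assume "monomial u"
    then obtain p m where m: "u = (\<lambda>x. p * x ^ (q ^ m))" by (auto simp: monomial_def)
    show ?thesis
    \<comment> \<open>Here \<open>P1\<close> is \<open>u\<close> after \<open>P2\<close>, so the
      twist is moved onto \<open>R2\<close> at coordinate \<open>i\<close>.\<close>
    proof (rule linear_equivI[OF pos J_def lin_bij_comp[OF lin_bij_frob[of m] R2(2)] R1(2,1) _ rel1])
      fix j x assume j: "j \<in> J" and x: "x \<in> C" "x ! k = 0" "x ! j = 0"
      have "P1 (x ! l) = u (P2 (x ! l))" by (simp add: u_def lin_bij_inv_left[OF R2(1)])
      also have "\<dots> = p * a j ^ (q ^ m) * R2 (x ! i) ^ (q ^ m)"
        unfolding rel2[OF j x] by (simp add: m power_mult_distrib)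
      finally show "P1 (x ! l) = p * a j ^ (q ^ m) * R2 (x ! i) ^ (q ^ m)" .
    qed
  next
    assume "monomial v"
    then obtain p m where m: "v = (\<lambda>x. p * x ^ (q ^ m))" by (auto simp: monomial_def)
    show ?thesis
    \<comment> \<open>Now \<open>P2\<close> and \<open>R2\<close> are kept, and the twist goes to
      coordinate \<open>k\<close> through \<open>P3\<close>.\<close>
    proof (rule linear_equivI[OF pos J_def R2(2) lin_bij_comp[OF lin_bij_frob[of m] R3(1)] R2(1) rel2])
      fix j x assume j: "j \<in> J" and x: "x \<in> C" "x ! i = 0" "x ! j = 0"
      \<comment> \<open>Chosen so that \<open>c j * w\<close> is \<open>P3 (x ! k)\<close>, which
        \<open>t\<close> sends to \<open>R1 (x ! k)\<close>.\<close>
      define w where "w = P3 (x ! k) / c j"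
      have "t (c j * w) = R1 (x ! k)"
        using R3(3)[OF j] by (simp add: w_def t_def lin_bij_inv_left[OF R3(1)])
      hence "P1 (- (x ! l)) = P1 (inv P2 (a j * v w))"
        using rel[OF j, of w] rel1[OF j x] by (simp add: u_def lin_bij_minus[OF R1(1)])
      hence "P2 (- (x ! l)) = a j * v w"
        by (simp add: lin_bij_eq_iff[OF R1(1)] lin_bij_inv_right[OF R2(1)])
      hence "- P2 (x ! l) = a j * v w" by (simp add: lin_bij_minus[OF R2(1)])
      hence "P2 (x ! l) = - (a j * v w)" by (metis minus_minus)
      also have "\<dots> = - (a j * p * inverse (c j) ^ (q ^ m)) * P3 (x ! k) ^ (q ^ m)"
        by (simp add: m w_def divide_inverse power_mult_distrib)
      finally show "P2 (x ! l) = - (a j * p * inverse (c j) ^ (q ^ m)) * P3 (x ! k) ^ (q ^ m)" .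
    qed
  qed
qed

end

theorem theorem1p1:
  fixes q h n :: nat
    and F :: "('a::{finite,field}) set"
    and C :: "'a list set"
  assumes "prime_power q"
    and "h \<ge> 1"
    and "card (UNIV :: 'a set) = q ^ h"
    and "is_subfield F" and "card F = q"
    and "F_linear_code F n C"
    and "is_nMd_code n (q ^ (3 * h)) (n - 2) C"
    and "is_MDS n C"
    and "(h = 2 \<and> n \<ge> 2 * q + 3) \<or>
         (h = 3 \<and> n \<ge> q ^ 2 + 3 + (if q = 2 then 1 else 0))"
    and "\<exists>S. S \<subseteq> {..<n} \<and> card S \<ge> 3 \<and>
           (\<forall>i\<in>S. \<exists>D. linear_code (n - 1) D \<and> F_equiv F (n - 1) (proj i C) D)"
  shows "\<exists>D. linear_code n D \<and> F_equiv F n C D"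
proof -
  interpret additive_mds_code F q h C n
    using assms(1-7) by unfold_locales (auto simp: is_nMd_code_def)
  obtain S where S: "S \<subseteq> {..<n}" "card S \<ge> 3"
    "\<And>i. i \<in> S \<Longrightarrow> \<exists>D. linear_code (n - 1) D \<and> F_equiv F (n - 1) (proj i C) D"
    using assms(10) by blast
  obtain T where T: "T \<subseteq> S" "card T = 3" using S(2) by (meson obtain_subset_with_card_n)
  obtain i k l where ikl: "T = {i, k, l}" "distinct [i, k, l]"
    using T(2) by (auto simp: card_3_iff)
  have h: "h = 2 \<or> h = 3" using assms(9) by blast
  \<comment> \<open>The maximum is \<open>2 * (q - 1)\<close> for \<open>h = 2\<close>, and below
    \<open>q ^ 2\<close> for \<open>h = 3\<close>.\<close>
  have "max (q ^ (h - 1) - 1) (h * (q - 1)) + 3 < n"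
    using assms(9)
  proof
    assume *: "h = 2 \<and> 2 * q + 3 \<le> n"
    hence "2 * (q - 1) + 3 < n" "q - 1 + 3 < n" using q_gt_1 by linarith+
    thus ?thesis using * by simp
  next
    assume *: "h = 3 \<and> q ^ 2 + 3 + (if q = 2 then 1 else 0) \<le> n"
    have "3 * (q - 1) < q ^ 2"
    proof (cases "q = 2")
      case False
      hence "3 * q \<le> q * q" using q_gt_1 by (intro mult_right_mono) auto
      thus ?thesis using q_gt_1 unfolding power2_eq_square by linarith
    qed simp
    moreover have "q ^ 2 - 1 < q ^ 2" using q_gt_1 by simp
    moreover have "q ^ 2 + 3 \<le> n" using * by linarith
    ultimately show ?thesis using * by simp
  qed
  from linear_if_three_projections_linear[OF h this, of i k l] show ?thesis
    using S T ikl by auto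
qed

end
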